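(* Let $\Omega\subset\mathbb{R}^n$, $n\ge1$, be a bounded open set with Lipschitz boundary. Let $G$ and $H$ be Young functions satisfying the $\Delta'$ condition and assume that $T_g<\infty$. Let $w\in L^\infty(\Omega)$ be a non-negative weight function which is not a.e. zero, and let $\lambda_1=\lambda_{1,1}$ be the first eigenvalue (at energy level $1$) of $$-\operatorname{div}\left(g(|\nabla u|)\frac{\nabla u}{|\nabla u|}\right)=\lambda\, w(x)\,h(|u|)\frac{u}{|u|}\ \text{ in }\Omega,\qquad u=0\ \text{ on }\partial\Omega,$$ where $g=G'$, $h=H'$. Then there are positive constants $c_3$ and $\hat c_3$ such that $$\left[G\left(\frac{c_3\,\sigma(r_\Omega)}{H^{-1}\left(\|w\|_{L^1(\Omega)}^{-1}\right)}\right)\right]^{-1}\le\lambda_1 \qquad\text{and}\qquad \left[G\left(\frac{\hat c_3\,\sigma(r_\Omega)\,\tau_H(\Omega)}{H^{-1}\left(\|w\|_{L^\infty(\Omega)}^{-1}\right)}\right)\right]^{-1}\le\lambda_1,$$ where $\tau_H(\Omega):=|\Omega|\,(\tilde H)^{-1}(|\Omega|^{-1})$ with $\tilde H$ the complementary function of $H$, $r_\Omega=\max\{\operatorname{dist}(x,\partial\Omega):x\in\Omega\}$ is the inner radius of $\Omega$, and $$\sigma(t)=\int_{t^{-n}}^\infty\frac{G^{-1}(s)}{s^{1+\frac1n}}\,ds.$$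
   Context: Young functions. A Young function is a map $G:[0,\infty)\to[0,\infty)$ of the form $G(t)=\int_0^t g(s)\,ds$ with $g=G'$ right-continuous on $[0,\infty)$, $g(0)=0$, $g(t)>0$ for $t>0$, $g$ nondecreasing, and $\lim_{t\to\infty}g(t)=\infty$. The Young functions $G,H$ are normalized by $G(1)=H(1)=1$, have absolutely continuous derivatives, and satisfy, for constants $1\le p^-\le p^+<\infty$, $p^-\le \frac{tG'(t)}{G(t)}\le p^+$ for all $t>0$ (same for $H$). $G$ satisfies the $\Delta'$ condition if there is a constant $C\ge 1$ with $G(ab)\le C\,G(a)G(b)$ for all $a,b\ge0$. The complementary function is $\tilde H(t)=\sup\{ta-H(a): a>0\}$. $T_g:=\int_1^\infty \frac{G^{-1}(s)}{s^{1+1/n}}\,ds$. Spaces. $\|u\|_G=\inf\{\delta>0:\int_\Omega G(|u|/\delta)\,dx\le1\}$; $L^G(\Omega)$ is the set of measurable $u$ with $\int_\Omega G(|u|)\,dx<\infty$; $W^{1,G}(\Omega)=\{u\in L^G(\Omega):|\nabla u|\in L^G(\Omega)\}$ and $W^{1,G}_0(\Omega)$ is the closure of $C_c^\infty(\Omega)$ in $W^{1,G}(\Omega)$ for the norm $\|u\|_G+\|\nabla u\|_G$. First eigenvalue. For $\mu>0$ let $\mathcal{A}_\mu=\{u\in W_0^{1,G}(\Omega):\int_\Omega wH(|u|)\,dx=\mu\}$ and $$\lambda_{1,\mu}=\inf\left\{\frac{\int_\Omega G(|\nabla u|)\,dx}{\int_\Omega wH(|u|)\,dx}: u\in\mathcal{A}_\mu\right\};\qquad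 \lambda_1:=\lambda_{1,1}.$$ *)

theory Defs
  imports "HOL-Analysis.Analysis" "HOL-Probability.Essential_Supremum"
begin

text \<open>Functions on \<open>[0,\<infinity>)\<close> are represented by functions on \<^typ>\<open>real\<close> of which only the values
  on \<open>{0..}\<close> are constrained and used.\<close>

definition young_function :: "(real \<Rightarrow> real) \<Rightarrow> (real \<Rightarrow> real) \<Rightarrow> bool" where
  "young_function G g \<longleftrightarrow>
     (\<forall>t\<ge>0. (g has_integral G t) {0..t}) \<and>
     (\<forall>t\<ge>0. continuous (at_right t) g) \<and>
     g 0 = 0 \<and> (\<forall>t>0. g t > 0) \<and> mono_on {0..} g \<and> filterlim g at_top at_top"

definition absolutely_continuous_on_Icc :: "real \<Rightarrow> real \<Rightarrow> (real \<Rightarrow> real) \<Rightarrow> bool" where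
  "absolutely_continuous_on_Icc a b f \<longleftrightarrow>
     (\<forall>\<epsilon>>0. \<exists>\<delta>>0. \<forall>F :: (real \<times> real) set.
        finite F \<and> (\<forall>(x, y)\<in>F. a \<le> x \<and> x \<le> y \<and> y \<le> b) \<and>
        pairwise (\<lambda>(x, y) (x', y'). disjnt {x<..<y} {x'<..<y'}) F \<and>
        (\<Sum>(x, y)\<in>F. y - x) < \<delta>
        \<longrightarrow> (\<Sum>(x, y)\<in>F. \<bar>f y - f x\<bar>) < \<epsilon>)"

text \<open>The standing assumptions on a Young function \<open>G\<close> with derivative \<open>g\<close>. Absolute continuity of
  \<open>g\<close> is understood locally, i.e. on every bounded interval (as it must be for \<open>G t = t\<^sup>3\<close>, say).\<close>

definition regular_young_function :: "(real \<Rightarrow> real) \<Rightarrow> (real \<Rightarrow> real) \<Rightarrow> bool" where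
  "regular_young_function G g \<longleftrightarrow>
     young_function G g \<and> G 1 = 1 \<and>
     (\<forall>T>0. absolutely_continuous_on_Icc 0 T g) \<and>
     (\<exists>p q. 1 \<le> p \<and> p \<le> q \<and> (\<forall>t>0. p \<le> t * g t / G t \<and> t * g t / G t \<le> q))"

definition Delta_prime :: "(real \<Rightarrow> real) \<Rightarrow> bool" where
  "Delta_prime G \<longleftrightarrow> (\<exists>C\<ge>1. \<forall>a\<ge>0. \<forall>b\<ge>0. G (a * b) \<le> C * G a * G b)"

definition complementary :: "(real \<Rightarrow> real) \<Rightarrow> real \<Rightarrow> real" where
  "complementary H t = (SUP a\<in>{0<..}. t * a - H a)"

text \<open>Young functions as above and their complementary functions are bijections of \<open>[0,\<infinity>)\<close>;
  \<open>young_inv G\<close> is the inverse bijection.\<close>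

definition young_inv :: "(real \<Rightarrow> real) \<Rightarrow> real \<Rightarrow> real" where
  "young_inv G = inv_into {0..} G"

definition T_int :: "(real \<Rightarrow> real) \<Rightarrow> nat \<Rightarrow> ennreal" where
  "T_int G n = (\<integral>\<^sup>+s\<in>{1..}. ennreal (young_inv G s / s powr (1 + 1 / real n)) \<partial>lborel)"

definition morrey_sigma :: "(real \<Rightarrow> real) \<Rightarrow> nat \<Rightarrow> real \<Rightarrow> real" where
  "morrey_sigma G n t = (LBINT s:{t powr (- real n)..}. young_inv G s / s powr (1 + 1 / real n))"

text \<open>The modular is a nonnegative integral with values in \<open>[0,\<infinity>]\<close>: a Bochner integral would return \<open>0\<close>
  for non-integrable functions, which would then satisfy the bounds below.\<close>

definition modular :: "(real \<Rightarrow> real) \<Rightarrow> (real ^ 'n) set \<Rightarrow> (real ^ 'n \<Rightarrow> real) \<Rightarrow> ennreal" where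
  "modular G \<Omega> u = (\<integral>\<^sup>+x. ennreal (G \<bar>u x\<bar>) \<partial>lebesgue_on \<Omega>)"

definition luxemburg_norm :: "(real \<Rightarrow> real) \<Rightarrow> (real ^ 'n) set \<Rightarrow> (real ^ 'n \<Rightarrow> real) \<Rightarrow> real" where
  "luxemburg_norm G \<Omega> u = Inf {\<delta>. \<delta> > 0 \<and> modular G \<Omega> (\<lambda>x. u x / \<delta>) \<le> 1}"

definition orlicz_space :: "(real \<Rightarrow> real) \<Rightarrow> (real ^ 'n) set \<Rightarrow> (real ^ 'n \<Rightarrow> real) set" where
  "orlicz_space G \<Omega> = {u \<in> borel_measurable (lebesgue_on \<Omega>). modular G \<Omega> u < \<infinity>}"

definition partial_deriv :: "'n \<Rightarrow> (real ^ 'n \<Rightarrow> real) \<Rightarrow> real ^ 'n \<Rightarrow> real" where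
  "partial_deriv i f x = frechet_derivative f (at x) (axis i 1)"

fun C_k :: "nat \<Rightarrow> (real ^ 'n \<Rightarrow> real) \<Rightarrow> bool" where
  "C_k 0 f \<longleftrightarrow> continuous_on UNIV f"
| "C_k (Suc k) f \<longleftrightarrow> (\<forall>x. f differentiable (at x)) \<and> (\<forall>i. C_k k (partial_deriv i f))"

text \<open>Elements of \<open>C\<^sub>c\<^sup>\<infinity>(\<Omega>)\<close>, extended by zero to the whole space.\<close>

definition test_functions :: "(real ^ 'n) set \<Rightarrow> (real ^ 'n \<Rightarrow> real) set" where
  "test_functions \<Omega> =
     {\<phi>. (\<forall>k. C_k k \<phi>) \<and> compact (closure {x. \<phi> x \<noteq> 0}) \<and> closure {x. \<phi> x \<noteq> 0} \<subseteq> \<Omega>}"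

definition locally_integrable ::
    "(real ^ 'n) set \<Rightarrow> (real ^ 'n \<Rightarrow> 'b::euclidean_space) \<Rightarrow> bool" where
  "locally_integrable \<Omega> u \<longleftrightarrow>
     u \<in> borel_measurable (lebesgue_on \<Omega>) \<and>
     (\<forall>K. compact K \<and> K \<subseteq> \<Omega> \<longrightarrow> integrable (lebesgue_on K) u)"

definition has_weak_gradient ::
    "(real ^ 'n) set \<Rightarrow> (real ^ 'n \<Rightarrow> real) \<Rightarrow> (real ^ 'n \<Rightarrow> real ^ 'n) \<Rightarrow> bool" where
  "has_weak_gradient \<Omega> u v \<longleftrightarrow>
     locally_integrable \<Omega> u \<and> locally_integrable \<Omega> v \<and>
     (\<forall>\<phi>\<in>test_functions \<Omega>. \<forall>i.
        (LINT x|lebesgue_on \<Omega>. u x * partial_deriv i \<phi> x) =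
        - (LINT x|lebesgue_on \<Omega>. v x $ i * \<phi> x))"

text \<open>The weak gradient is unique up to null sets of \<open>\<Omega>\<close>; we pick a representative.\<close>

definition weak_gradient ::
    "(real ^ 'n) set \<Rightarrow> (real ^ 'n \<Rightarrow> real) \<Rightarrow> real ^ 'n \<Rightarrow> real ^ 'n" where
  "weak_gradient \<Omega> u = (SOME v. has_weak_gradient \<Omega> u v)"

definition orlicz_sobolev :: "(real \<Rightarrow> real) \<Rightarrow> (real ^ 'n) set \<Rightarrow> (real ^ 'n \<Rightarrow> real) set" where
  "orlicz_sobolev G \<Omega> =
     {u \<in> orlicz_space G \<Omega>. (\<exists>v. has_weak_gradient \<Omega> u v) \<and>
        (\<lambda>x. norm (weak_gradient \<Omega> u x)) \<in> orlicz_space G \<Omega>}"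

definition sobolev_norm :: "(real \<Rightarrow> real) \<Rightarrow> (real ^ 'n) set \<Rightarrow> (real ^ 'n \<Rightarrow> real) \<Rightarrow> real" where
  "sobolev_norm G \<Omega> u =
     luxemburg_norm G \<Omega> u + luxemburg_norm G \<Omega> (\<lambda>x. norm (weak_gradient \<Omega> u x))"

definition orlicz_sobolev_0 :: "(real \<Rightarrow> real) \<Rightarrow> (real ^ 'n) set \<Rightarrow> (real ^ 'n \<Rightarrow> real) set" where
  "orlicz_sobolev_0 G \<Omega> =
     {u \<in> orlicz_sobolev G \<Omega>.
        \<forall>\<epsilon>>0. \<exists>\<phi>\<in>test_functions \<Omega>. sobolev_norm G \<Omega> (\<lambda>x. u x - \<phi> x) < \<epsilon>}"

definition admissible ::
    "(real \<Rightarrow> real) \<Rightarrow> (real \<Rightarrow> real) \<Rightarrow> (real ^ 'n) set \<Rightarrow> (real ^ 'n \<Rightarrow> real) \<Rightarrow> real \<Rightarrow>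
     (real ^ 'n \<Rightarrow> real) set" where
  "admissible G H \<Omega> w \<mu> =
     {u \<in> orlicz_sobolev_0 G \<Omega>. (LINT x|lebesgue_on \<Omega>. w x * H \<bar>u x\<bar>) = \<mu>}"

definition first_eigenvalue ::
    "(real \<Rightarrow> real) \<Rightarrow> (real \<Rightarrow> real) \<Rightarrow> (real ^ 'n) set \<Rightarrow> (real ^ 'n \<Rightarrow> real) \<Rightarrow> real \<Rightarrow> real" where
  "first_eigenvalue G H \<Omega> w \<mu> =
     (INF u\<in>admissible G H \<Omega> w \<mu>.
        (LINT x|lebesgue_on \<Omega>. G (norm (weak_gradient \<Omega> u x))) /
        (LINT x|lebesgue_on \<Omega>. w x * H \<bar>u x\<bar>))"

text \<open>Near each boundary point, \<open>\<Omega>\<close> is the strict epigraph of a Lipschitz function in suitable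
  orthonormal coordinates: \<open>e\<close> is the vertical unit vector, \<open>x - (x \<bullet> e) *\<^sub>R e\<close> the horizontal part.\<close>

definition lipschitz_boundary :: "(real ^ 'n) set \<Rightarrow> bool" where
  "lipschitz_boundary \<Omega> \<longleftrightarrow>
     (\<forall>z\<in>frontier \<Omega>. \<exists>r>0. \<exists>e \<gamma> L. norm e = 1 \<and> lipschitz_on L {y. y \<bullet> e = 0} \<gamma> \<and>
        \<Omega> \<inter> ball z r = {x \<in> ball z r. x \<bullet> e > \<gamma> (x - (x \<bullet> e) *\<^sub>R e)})"

definition inner_radius :: "(real ^ 'n) set \<Rightarrow> real" where
  "inner_radius \<Omega> = (SUP x\<in>\<Omega>. infdist x (frontier \<Omega>))"

definition tau :: "(real \<Rightarrow> real) \<Rightarrow> (real ^ 'n) set \<Rightarrow> real" where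
  "tau H \<Omega> = measure lebesgue \<Omega> * young_inv (complementary H) (inverse (measure lebesgue \<Omega>))"

definition L1_norm :: "(real ^ 'n) set \<Rightarrow> (real ^ 'n \<Rightarrow> real) \<Rightarrow> real" where
  "L1_norm \<Omega> w = (LINT x|lebesgue_on \<Omega>. \<bar>w x\<bar>)"

definition Linf_space :: "(real ^ 'n) set \<Rightarrow> (real ^ 'n \<Rightarrow> real) set" where
  "Linf_space \<Omega> =
     {w \<in> borel_measurable (lebesgue_on \<Omega>). esssup (lebesgue_on \<Omega>) (\<lambda>x. ereal \<bar>w x\<bar>) < \<infinity>}"

definition Linf_norm :: "(real ^ 'n) set \<Rightarrow> (real ^ 'n \<Rightarrow> real) \<Rightarrow> real" where
  "Linf_norm \<Omega> w = real_of_ereal (esssup (lebesgue_on \<Omega>) (\<lambda>x. ereal \<bar>w x\<bar>))"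

end

theory Submission
  imports Defs
begin

text \<open>Let \<open>u\<close> be a test function with \<open>\<integral> G(|\<nabla>u|/\<delta>) \<le> 1\<close>, and let \<open>Q\<close> be a cube of side \<open>r\<close> with \<open>x \<in> Q\<close>. Integrating
  \<open>\<nabla>u\<close> along the segments from \<open>x\<close> and averaging over \<open>y \<in> Q\<close>, the average of \<open>|u y - u x|\<close> is at most
  \<open>n r \<integral>\<^sub>0\<^sup>1\<close> of the mean of \<open>|\<nabla>u|\<close> over the shrunken cube \<open>x + t (Q - x)\<close>. By Jensen this mean is at most
  \<open>\<delta> G\<^sup>-\<^sup>1((t r)\<^sup>-\<^sup>n)\<close>, and the substitution \<open>s = (t r)\<^sup>-\<^sup>n\<close> turns the bound into \<open>\<delta> \<sigma>(r)\<close>. Comparing \<open>x\<close> with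
  its nearest boundary point gives \<open>|u| \<le> 2 \<delta> \<sigma>(r\<^sub>\<Omega>)\<close>, which extends to \<open>W\<^sub>0\<^sup>1\<^sup>,\<^sup>G\<close> because weak gradients are unique.

  By \<open>\<Delta>'\<close>, \<open>C G(1/\<delta>) \<integral> G(|\<nabla>u|) \<le> 1\<close> is enough for the hypothesis. If an admissible \<open>u\<close> violated one of the
  two bounds, a suitable \<open>\<delta>\<close> would make \<open>|u|\<close> so small that \<open>\<integral> w H(|u|) \<le> 1/2\<close>; the factor \<open>\<tau>\<^sub>H\<close> enters through
  \<open>s \<le> H\<^sup>-\<^sup>1(s) H~\<^sup>-\<^sup>1(s)\<close> at \<open>s = 1/|\<Omega>|\<close>. Finally, the infimum in \<open>first_eigenvalue\<close> is meaningful
  only for a nonempty admissible set, and this requires a test function on which \<open>w\<close> does not vanish.\<close>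

section \<open>Young functions\<close>

text \<open>The constants are 4C and 4CE, where C and E are the \<open>Delta_prime\<close> constants
  of G and H, so they serve all \<Omega> and w at once. One factor 2 comes from comparing a point
  and its boundary point with the same mean; a second halves the argument of H, so that convexity
  makes the energy at most 1/2 instead of the prescribed 1. The factor C is absorbed by C
  G(1/\<delta>) \<le> G(C/\<delta>), and E pays for splitting H at a product.

  Cubes fit better than balls. A cube shrunk by t towards one of its points is a cube of measure
  exactly (t r)^n, so the value 1/m that Jensen puts into the inverse of G is precisely the
  substitution variable s. The l1 bound n r on the diameter is precisely the factor that ds
  produces. Hence no dimensional constant is left in front of \<sigma>.

  Two totalized notions shape the technical part. \<open>weak_gradient\<close> is an arbitrary
  choice, known only up to null sets, and \<open>luxemburg_norm\<close> is an \<open>Inf\<close>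
  that says something only over a nonempty set. The estimates up to Morrey's inequality use
  nonnegative integrals, so that Tonelli and Jensen need no integrability.\<close>

locale young =
  fixes G g :: "real \<Rightarrow> real"
  assumes young: "young_function G g" and one: "G 1 = 1"
begin

lemma has_integral: "0 \<le> t \<Longrightarrow> (g has_integral G t) {0..t}"
  and g_mono: "0 \<le> s \<Longrightarrow> s \<le> t \<Longrightarrow> g s \<le> g t"
  and g_pos: "0 < t \<Longrightarrow> 0 < g t"
  and g_0: "g 0 = 0"
  and g_at_top: "filterlim g at_top at_top"
  using young by (auto simp: young_function_def mono_on_def)

lemma G_0 [simp]: "G 0 = 0"
  using has_integral_unique[OF has_integral[of 0, simplified] has_integral_refl(2)] .

lemma g_nonneg: "0 \<le> t \<Longrightarrow> 0 \<le> g t"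
  using g_pos[of t] g_0 by (cases "t = 0") auto

lemma has_integral_diff:
  assumes "0 \<le> a" "a \<le> b"
  shows "(g has_integral (G b - G a)) {a..b}"
proof -
  have "g integrable_on {a..b}"
    by (rule integrable_subinterval_real[of g 0 b])
      (use has_integral_integrable[OF has_integral[of b]] assms in simp_all)
  then obtain i where i: "(g has_integral i) {a..b}" unfolding integrable_on_def ..
  have "(g has_integral (G a + i)) {0..b}"
    by (rule has_integral_combine[OF assms has_integral[OF assms(1)] i])
  then have "G b = G a + i"
    by (intro has_integral_unique[OF has_integral[of b]]) (use assms in linarith)
  then show ?thesis using i by simp
qed

text \<open>The nondecreasing \<open>g\<close> stays above \<open>g a\<close> to the right of
  \<open>a\<close> and below it to the left, so integration from \<open>a\<close> gives the
  supporting line on both sides. Convexity, strict monotonicity and Jensen's inequality all come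
  from it.\<close>

lemma tangent_le:
  assumes "0 \<le> a" "0 \<le> b"
  shows "G a + g a * (b - a) \<le> G b"
proof (cases "a \<le> b")
  case True
  have "((\<lambda>x. g a) has_integral (g a * (b - a))) {a..b}"
    using has_integral_const_real[of "g a" a b] True by (simp add: mult.commute)
  from has_integral_le[OF this has_integral_diff[OF assms(1) True]] show ?thesis
    using g_mono[OF assms(1)] by auto
next
  case False
  then have "b \<le> a" by simp
  have "((\<lambda>x. g a) has_integral (g a * (a - b))) {b..a}"
    using has_integral_const_real[of "g a" b a] \<open>b \<le> a\<close> by (simp add: mult.commute)
  from has_integral_le[OF has_integral_diff[OF assms(2) \<open>b \<le> a\<close>] this] show ?thesis
    using g_mono assms by (auto simp: algebra_simps)
qed

lemma convex_G: "convex_on {0..} G"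
proof (rule convex_onI)
  fix t x y :: real
  assume t: "0 < t" "t < 1" and xy: "x \<in> {0..}" "y \<in> {0..}"
  \<comment> \<open>Supporting line at the convex combination: in the weighted sum of the
    inequalities at \<open>x\<close> and \<open>y\<close> the slope terms cancel.\<close>
  define a where "a = (1 - t) * x + t * y"
  have a: "0 \<le> a" unfolding a_def using t xy by simp
  have "(1 - t) * (G a + g a * (x - a)) \<le> (1 - t) * G x"
    using tangent_le[OF a, of x] t xy by (intro mult_left_mono) auto
  moreover have "t * (G a + g a * (y - a)) \<le> t * G y"
    using tangent_le[OF a, of y] t xy by (intro mult_left_mono) auto
  moreover have "(1 - t) * (G a + g a * (x - a)) + t * (G a + g a * (y - a)) = G a"
    by (simp add: a_def algebra_simps)
  ultimately show "G ((1 - t) *\<^sub>R x + t *\<^sub>R y) \<le> (1 - t) * G x + t * G y"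
    unfolding a_def by simp
qed auto

lemma scale_le:
  assumes "0 \<le> c" "c \<le> 1" "0 \<le> t"
  shows "G (c * t) \<le> c * G t"
  using convex_onD[OF convex_G, of c 0 t] assms by simp

lemma strict_mono_G:
  assumes "0 \<le> a" "a < b"
  shows "G a < G b"
proof -
  \<comment> \<open>The slope at \<open>a\<close> vanishes when \<open>a = 0\<close>, so strictness
    is drawn from the tangent at the midpoint, where \<open>g\<close> is positive.\<close>
  define m where "m = (a + b) / 2"
  have m: "a < m" "m < b" "0 < m" using assms by (auto simp: m_def)
  have "G a \<le> G m" using tangent_le[of a m] g_nonneg[of a] assms m
    by (smt (verit) mult_nonneg_nonneg)
  moreover have "G m < G b" using tangent_le[of m b] g_pos[of m] assms m
    by (smt (verit) mult_pos_pos)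
  ultimately show ?thesis by simp
qed

lemma mono_G: "0 \<le> a \<Longrightarrow> a \<le> b \<Longrightarrow> G a \<le> G b"
  using strict_mono_G[of a b] by (cases "a = b") auto

lemma G_less_iff: "0 \<le> a \<Longrightarrow> 0 \<le> b \<Longrightarrow> G a < G b \<longleftrightarrow> a < b"
  using strict_mono_G[of a b] mono_G[of b a] by linarith

lemma G_pos: "0 < t \<Longrightarrow> 0 < G t"
  using strict_mono_G[of 0 t] by simp

lemma G_nonneg: "0 \<le> t \<Longrightarrow> 0 \<le> G t"
  using mono_G[of 0 t] by simp

text \<open>Convexity together with the normalization at 1. This growth gives surjectivity onto the
  half-line and, later, Chebyshev's inequality for the modular.\<close>

lemma G_ge: "1 \<le> t \<Longrightarrow> t \<le> G t"
  using scale_le[of "1/t" t] one by (simp add: field_simps)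

lemma scale_ge: "1 \<le> c \<Longrightarrow> 0 \<le> t \<Longrightarrow> c * G t \<le> G (c * t)"
  using scale_le[of "1/c" "c * t"] by (simp add: field_simps)

lemma continuous_on_G: "continuous_on {0..} G"
proof -
  have 1: "continuous_on {0..T} G" if "0 \<le> T" for T
  proof -
    have "continuous_on {0..T} (\<lambda>x. integral {0..x} g)"
      by (rule indefinite_integral_continuous_1[OF has_integral_integrable[OF has_integral[OF that]]])
    moreover have "integral {0..x} g = G x" if "x \<in> {0..T}" for x
      by (rule integral_unique[OF has_integral]) (use that in simp)
    ultimately show ?thesis using continuous_on_eq by blast
  qed
  show ?thesis
    unfolding continuous_on_eq_continuous_within
  proof
    fix x :: real assume x: "x \<in> {0..}"
    have "continuous (at x within {0..x+1}) G"
      using 1[of "x+1"] x by (simp add: continuous_on_eq_continuous_within)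
    moreover have "at x within {0..} = at x within {0..x+1}"
      by (rule at_within_nhd[of _ "{..<x+1}"]) auto
    ultimately show "continuous (at x within {0..}) G" by simp
  qed
qed

lemma continuous_on_G_abs: "continuous_on UNIV (\<lambda>x. G \<bar>x\<bar>)"
  by (rule continuous_on_compose2[OF continuous_on_G]) (auto intro: continuous_intros)

lemma borel_measurable_G_abs [measurable]: "(\<lambda>x. G \<bar>x\<bar>) \<in> borel_measurable borel"
  using continuous_on_G_abs by (rule borel_measurable_continuous_onI)

lemma borel_measurable_G_norm:
  fixes f :: "'a \<Rightarrow> 'b::real_normed_vector"
  assumes "f \<in> borel_measurable M"
  shows "(\<lambda>x. G (norm (f x))) \<in> borel_measurable M"
proof -
  have "(\<lambda>x. G \<bar>norm (f x)\<bar>) \<in> borel_measurable M"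
    using assms by measurable
  then show ?thesis by simp
qed

section \<open>The inverse of a Young function and its complementary function\<close>

lemma G_image:
  assumes "0 \<le> s"
  obtains t where "0 \<le> t" "G t = s"
proof -
  have "\<exists>t\<ge>0. t \<le> max 1 s \<and> G t = s"
  proof (rule IVT')
    show "s \<le> G (max 1 s)" using G_ge[of "max 1 s"] by simp
    show "continuous_on {0..max 1 s} G" by (rule continuous_on_subset[OF continuous_on_G]) auto
  qed (use assms in auto)
  then show thesis using that by blast
qed

lemma young_inv_nonneg: "0 \<le> s \<Longrightarrow> 0 \<le> young_inv G s"
  and G_young_inv: "0 \<le> s \<Longrightarrow> G (young_inv G s) = s"
proof -
  assume "0 \<le> s"
  then obtain t where "0 \<le> t" "G t = s" by (rule G_image)
  then have "s \<in> G ` {0..}" by auto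
  then show "0 \<le> young_inv G s" "G (young_inv G s) = s"
    unfolding young_inv_def using inv_into_into[of s G "{0..}"] f_inv_into_f[of s G "{0..}"] by simp_all
qed

lemma young_inv_pos: "0 < s \<Longrightarrow> 0 < young_inv G s"
  using young_inv_nonneg[of s] G_young_inv[of s] by (auto simp: order.order_iff_strict)

lemma young_inv_mono: "0 \<le> s \<Longrightarrow> s \<le> t \<Longrightarrow> young_inv G s \<le> young_inv G t"
  using G_less_iff[of "young_inv G t" "young_inv G s"] G_young_inv[of s] G_young_inv[of t] young_inv_nonneg[of s]
    young_inv_nonneg[of t] by linarith

text \<open>The complementary function is at most \<open>s\<close> at \<open>s / G\<^sup>-\<^sup>1 s\<close>, since \<open>b \<mapsto> G b / b\<close> increases.\<close>

lemma le_young_inv_mult_complementary: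
  assumes s: "0 < s"
  shows "s \<le> young_inv G s * young_inv (complementary G) s"
proof -
  let ?Gc = "complementary G"
  have bdd: "bdd_above ((\<lambda>a. t * a - G a) ` {0<..})" for t
  proof -
    \<comment> \<open>At a point \<open>m\<close> whose slope has reached \<open>t\<close>, the
      tangent bounds \<open>t * a - G a\<close> uniformly in \<open>a\<close>.\<close>
    have "eventually (\<lambda>m. t \<le> g m) at_top" using g_at_top by (simp add: filterlim_at_top)
    then obtain N where "\<And>m. m \<ge> N \<Longrightarrow> t \<le> g m" by (auto simp: eventually_at_top_linorder)
    then have m: "max N 1 > 0" "t \<le> g (max N 1)" by auto
    define m where "m = max N 1"
    note m = m[folded m_def]
    have "t * a - G a \<le> g m * m - G m" if "0 < a" for a
    proof -
      have "t * a \<le> g m * a" using m that by (intro mult_right_mono) auto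
      then show ?thesis using tangent_le[of m a] m that unfolding right_diff_distrib by linarith
    qed
    then show ?thesis by (intro bdd_aboveI2) auto
  qed
  have up: "t * a - G a \<le> ?Gc t" if "0 < a" for t a
    unfolding complementary_def using bdd that by (intro cSUP_upper) auto
  have least: "?Gc t \<le> c" if "\<And>a. 0 < a \<Longrightarrow> t * a - G a \<le> c" for t c
    unfolding complementary_def using that by (intro cSUP_least) auto
  have cvx: "convex_on UNIV ?Gc"
  proof (rule convex_onI)
    fix u x y :: real
    assume u: "0 < u" "u < 1"
    have "((1 - u) * x + u * y) * a - G a \<le> (1 - u) * ?Gc x + u * ?Gc y" if "0 < a" for a
    proof -
      have "((1 - u) * x + u * y) * a - G a = (1 - u) * (x * a - G a) + u * (y * a - G a)"
        by (simp add: algebra_simps)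
      also have "\<dots> \<le> (1 - u) * ?Gc x + u * ?Gc y"
        using up[OF that] u by (intro add_mono mult_left_mono) auto
      finally show ?thesis .
    qed
    then show "?Gc ((1 - u) *\<^sub>R x + u *\<^sub>R y) \<le> (1 - u) * ?Gc x + u * ?Gc y"
      by (auto intro: least)
  qed auto
  \<comment> \<open>The supremum is finite for negative arguments too, so \<open>?Gc\<close> is
    convex on the whole line and therefore continuous. Then \<open>s\<close> is a value of
    \<open>?Gc\<close> on the half-line, and \<open>young_inv ?Gc s\<close> is a genuine
    preimage.\<close>
  have cont: "continuous_on UNIV ?Gc" by (rule convex_on_continuous[OF open_UNIV cvx])
  have 0: "?Gc 0 \<le> 0" using G_nonneg by (intro least) auto
  have "\<exists>t\<ge>0. t \<le> s + 1 \<and> ?Gc t = s"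
  proof (rule IVT')
    show "s \<le> ?Gc (s + 1)" using up[of 1 "s+1"] one by simp
  qed (use 0 s cont continuous_on_subset in auto)
  then have "s \<in> ?Gc ` {0..}" by auto
  then have t: "0 \<le> young_inv ?Gc s" "?Gc (young_inv ?Gc s) = s"
    unfolding young_inv_def using inv_into_into[of s ?Gc "{0..}"] f_inv_into_f[of s ?Gc "{0..}"] by simp_all
  define t where "t = young_inv ?Gc s"
  define a where "a = young_inv G s"
  have a: "0 < a" "G a = s" using young_inv_pos G_young_inv s by (auto simp: a_def)
  have le: "?Gc (s / a) \<le> s"
  proof (rule least)
    fix b :: real assume b: "0 < b"
    show "s / a * b - G b \<le> s"
    proof (cases "b \<le> a")
      case True
      have "s / a * b \<le> s" using True a s by (simp add: field_simps)
      then show ?thesis using G_pos[OF b] by simp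
    next
      case False
      then have "b / a * G a \<le> G (b / a * a)" using a by (intro scale_ge) auto
      then show ?thesis using a s by (simp add: mult.commute)
    qed
  qed
  \<comment> \<open>Scaling takes the place of strict monotonicity of \<open>?Gc\<close>: if
    \<open>t\<close> were smaller, the ratio \<open>k > 1\<close> would give
    \<open>?Gc t \<le> ?Gc (s / a) / k < s\<close>, against \<open>?Gc t = s\<close>.\<close>
  have "s / a \<le> t"
  proof (rule ccontr)
    assume "\<not> s / a \<le> t"
    have "t \<noteq> 0" using 0 t s by (auto simp: t_def)
    then have t0: "0 < t" using t by (simp add: t_def)
    define k where "k = s / a / t"
    have k: "1 < k" using \<open>\<not> s / a \<le> t\<close> t0 unfolding k_def by (subst pos_less_divide_eq) auto
    have "k * t = s / a" using t0 by (simp add: k_def)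
    have "?Gc t \<le> ?Gc (s / a) / k"
    proof (rule least)
      fix b :: real assume b: "0 < b"
      have "k * (t * b - G b) \<le> (k * t) * b - G b"
        using mult_right_mono[of 1 k "G b"] k G_pos[OF b] by (simp add: right_diff_distrib)
      also have "\<dots> \<le> ?Gc (s / a)" unfolding \<open>k * t = s / a\<close> by (rule up[OF b])
      finally show "t * b - G b \<le> ?Gc (s / a) / k"
        using k by (simp add: pos_le_divide_eq mult.commute)
    qed
    also have "\<dots> \<le> s / k" using le k by (simp add: divide_right_mono)
    also have "\<dots> < s" using k s by (simp add: field_simps)
    finally show False using t by (simp add: t_def)
  qed
  then show ?thesis using a by (simp add: field_simps t_def a_def)
qed

end

section \<open>Test functions\<close>

lemma partial_deriv_eq: "(f has_derivative f') (at x) \<Longrightarrow> partial_deriv i f x = f' (axis i 1)"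
  unfolding partial_deriv_def by (metis frechet_derivative_at)

lemma partial_deriv_mult:
  fixes f g :: "real ^ 'n \<Rightarrow> real"
  assumes "f differentiable (at x)" "g differentiable (at x)"
  shows "partial_deriv i (\<lambda>x. f x * g x) x = f x * partial_deriv i g x + partial_deriv i f x * g x"
proof -
  have "((\<lambda>x. f x * g x) has_derivative
      (\<lambda>h. f x * frechet_derivative g (at x) h + frechet_derivative f (at x) h * g x)) (at x)"
    using assms by (intro has_derivative_mult) (simp_all add: frechet_derivative_works)
  from partial_deriv_eq[OF this] show ?thesis by (simp add: partial_deriv_def)
qed

lemma partial_deriv_add:
  fixes f g :: "real ^ 'n \<Rightarrow> real"
  assumes "f differentiable (at x)" "g differentiable (at x)"
  shows "partial_deriv i (\<lambda>x. f x + g x) x = partial_deriv i f x + partial_deriv i g x"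
proof -
  have "((\<lambda>x. f x + g x) has_derivative
      (\<lambda>h. frechet_derivative f (at x) h + frechet_derivative g (at x) h)) (at x)"
    using assms by (intro has_derivative_add) (simp_all add: frechet_derivative_works)
  from partial_deriv_eq[OF this] show ?thesis by (simp add: partial_deriv_def)
qed

lemma partial_deriv_const: "partial_deriv i (\<lambda>x. c) x = 0"
  using partial_deriv_eq[OF has_derivative_const] .

lemma C_k_SucD: "C_k (Suc k) f \<Longrightarrow> C_k k f"
proof (induction k arbitrary: f)
  case 0
  then show ?case
    by (auto intro!: differentiable_imp_continuous_within simp: continuous_on_eq_continuous_within)
next
  case (Suc k)
  then show ?case by (metis C_k.simps(2))
qed

lemma C_k_const: "C_k k (\<lambda>x :: real ^ 'n. c)"
proof (induction k arbitrary: c)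
  case (Suc k)
  moreover have "partial_deriv i (\<lambda>x :: real ^ 'n. c) = (\<lambda>x. 0)" for i by (rule ext) (rule partial_deriv_const)
  ultimately show ?case by simp
qed simp

lemma C_k_add: "C_k k f \<Longrightarrow> C_k k g \<Longrightarrow> C_k k (\<lambda>x. f x + g x)"
proof (induction k arbitrary: f g)
  case 0
  then show ?case by (auto intro: continuous_on_add)
next
  case (Suc k)
  then have "partial_deriv i (\<lambda>x. f x + g x) = (\<lambda>x. partial_deriv i f x + partial_deriv i g x)" for i
    by (intro ext partial_deriv_add) auto
  with Suc show ?case by (auto intro: differentiable_add)
qed

lemma C_k_mult: "C_k k f \<Longrightarrow> C_k k g \<Longrightarrow> C_k k (\<lambda>x. f x * g x)"
proof (induction k arbitrary: f g)
  case 0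
  then show ?case by (auto intro: continuous_on_mult)
next
  case (Suc k)
  then have "partial_deriv i (\<lambda>x. f x * g x) = (\<lambda>x. f x * partial_deriv i g x + partial_deriv i f x * g x)" for i
    by (intro ext partial_deriv_mult) auto
  moreover have "C_k k (\<lambda>x. f x * partial_deriv i g x + partial_deriv i f x * g x)" for i
    using Suc C_k_SucD[OF Suc.prems(1)] C_k_SucD[OF Suc.prems(2)] by (intro C_k_add Suc.IH) simp_all
  ultimately show ?case using Suc.prems by (auto intro: differentiable_mult)
qed

lemma C_k_prod: "finite I \<Longrightarrow> (\<And>i. i \<in> I \<Longrightarrow> C_k k (f i)) \<Longrightarrow> C_k k (\<lambda>x. \<Prod>i\<in>I. f i x)"
  by (induction I rule: finite_induct) (auto intro: C_k_const C_k_mult)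

definition grad :: "(real ^ 'n \<Rightarrow> real) \<Rightarrow> real ^ 'n \<Rightarrow> real ^ 'n" where
  "grad f x = (\<chi> i. partial_deriv i f x)"

lemma grad_nth [simp]: "grad f x $ i = partial_deriv i f x"
  by (simp add: grad_def)

lemma has_derivative_grad:
  fixes f :: "real ^ 'n \<Rightarrow> real"
  assumes "f differentiable (at x)"
  shows "(f has_derivative (\<lambda>h. grad f x \<bullet> h)) (at x)"
proof -
  let ?D = "frechet_derivative f (at x)"
  have D: "(f has_derivative ?D) (at x)" using assms by (simp add: frechet_derivative_works)
  then interpret linear ?D by (rule has_derivative_linear)
  have "?D h = grad f x \<bullet> h" for h
  proof -
    have "?D h = ?D (\<Sum>i\<in>UNIV. h $ i *\<^sub>R axis i 1)"
      by (simp flip: scalar_mult_eq_scaleR add: basis_expansion)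
    also have "\<dots> = (\<Sum>i\<in>UNIV. h $ i * ?D (axis i 1))" by (simp add: sum scale)
    also have "\<dots> = grad f x \<bullet> h" by (simp add: inner_vec_def partial_deriv_def mult.commute)
    finally show ?thesis .
  qed
  then have "?D = (\<lambda>h. grad f x \<bullet> h)" by (rule ext)
  with D show ?thesis by metis
qed

text \<open>The polynomial factor makes the family closed under differentiation.\<close>

definition flat :: "real poly \<Rightarrow> real \<Rightarrow> real \<Rightarrow> real" where
  "flat p c s = (if 0 < s then poly p (1 / s) * exp (- c / s) else 0)"

lemma poly_times_exp_tendsto_0:
  assumes "0 < (c::real)"
  shows "((\<lambda>x. poly p x * exp (- c * x)) \<longlongrightarrow> 0) at_top"
proof -
  have lim: "filterlim (\<lambda>x. c * x) at_top at_top"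
    using assms by (intro filterlim_tendsto_pos_mult_at_top[OF tendsto_const _ filterlim_ident])
  have "((\<lambda>x. x ^ k * exp (- c * x)) \<longlongrightarrow> 0) at_top" for k
  proof -
    have "((\<lambda>x. inverse (c ^ k) * ((c * x) ^ k / exp (c * x))) \<longlongrightarrow> inverse (c ^ k) * 0) at_top"
      by (intro tendsto_mult tendsto_const filterlim_compose[OF tendsto_power_div_exp_0 lim])
    then show ?thesis using assms by (simp add: power_mult_distrib exp_minus field_simps)
  qed
  then have "((\<lambda>x. \<Sum>k\<le>degree p. coeff p k * (x ^ k * exp (- c * x))) \<longlongrightarrow>
      (\<Sum>k\<le>degree p. coeff p k * 0)) at_top"
    by (intro tendsto_sum tendsto_mult tendsto_const)
  then show ?thesis by (simp add: poly_altdef sum_distrib_right mult.assoc)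
qed

text \<open>With x = 1/s the chain rule gives x^2 (c p(x) - p'(x)) exp(-c x), again of the form
  \<open>flat\<close>; \<open>[:0,0,1:]\<close> is the monomial x^2. At 0 the exponential beats
  every power.\<close>

lemma DERIV_flat:
  assumes c: "0 < c"
  shows "(flat p c has_real_derivative flat ([:0,0,1:] * (smult c p - pderiv p)) c s) (at s)"
proof -
  consider "s < 0" | "s = 0" | "0 < s" by linarith
  then show ?thesis
  proof cases
    case 1
    have "((\<lambda>_. 0) has_real_derivative 0) (at s)" by simp
    then have "(flat p c has_real_derivative 0) (at s)"
      by (rule has_field_derivative_transform_within_open[of _ _ _ "{..<0}"]) (use 1 in \<open>auto simp: flat_def\<close>)
    then show ?thesis using 1 by (simp add: flat_def)
  next
    case 3
    have "((\<lambda>s. poly p (1 / s) * exp (- c / s)) has_real_derivative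
       (1 / s)\<^sup>2 * (c * poly p (1 / s) - poly (pderiv p) (1 / s)) * exp (- c / s)) (at s)"
      using 3 by (auto intro!: derivative_eq_intros DERIV_chain'[OF _ poly_DERIV] simp: field_simps power2_eq_square)
    then have "(flat p c has_real_derivative
       (1 / s)\<^sup>2 * (c * poly p (1 / s) - poly (pderiv p) (1 / s)) * exp (- c / s)) (at s)"
      by (rule has_field_derivative_transform_within_open[of _ _ _ "{0<..}"]) (use 3 in \<open>auto simp: flat_def\<close>)
    then show ?thesis using 3 by (simp add: flat_def power2_eq_square algebra_simps)
  next
    case 2
    have "((\<lambda>h. flat p c h / h) \<longlongrightarrow> 0) (at_right 0)"
    proof -
      \<comment> \<open>\<open>pCons 0 p\<close> is x p(x); the additional x = 1/h is the division
        by \<open>h\<close> in the difference quotient.\<close>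
      have "((\<lambda>x. poly (pCons 0 p) x * exp (- c * x)) \<longlongrightarrow> 0) at_top"
        by (rule poly_times_exp_tendsto_0[OF c])
      then have "((\<lambda>h. poly (pCons 0 p) (inverse h) * exp (- c * inverse h)) \<longlongrightarrow> 0) (at_right 0)"
        by (rule filterlim_compose[OF _ filterlim_inverse_at_top_right])
      then show ?thesis
        by (rule Lim_transform_eventually) (auto simp: eventually_at_filter flat_def field_simps)
    qed
    moreover have "((\<lambda>h. flat p c h / h) \<longlongrightarrow> 0) (at_left 0)"
      by (rule Lim_transform_eventually[OF tendsto_const]) (auto simp: eventually_at_filter flat_def)
    ultimately have "((\<lambda>h. flat p c h / h) \<longlongrightarrow> 0) (at 0)" by (simp add: filterlim_split_at)
    then show ?thesis using 2 by (simp add: DERIV_def flat_def)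
  qed
qed

text \<open>Each differentiation changes the polynomial, hence the induction over all
  \<open>p\<close>. Affine arguments suffice, since the bumps compose \<open>flat\<close> with
  coordinates only.\<close>

lemma C_k_flat_comp:
  fixes l :: "real ^ 'n \<Rightarrow> real"
  assumes c: "0 < c" and l: "bounded_linear l"
  shows "C_k k (\<lambda>x. flat p c (l x + d))"
proof (induction k arbitrary: p)
  case 0
  have "continuous_on UNIV (flat p c)"
    using DERIV_flat[OF c] by (intro DERIV_continuous_on) (auto intro: has_field_derivative_at_within)
  moreover have "continuous_on UNIV (\<lambda>x. l x + d)"
    by (intro continuous_intros linear_continuous_on l)
  ultimately show ?case by (auto intro: continuous_on_compose2)
next
  case (Suc k)
  define q where "q = [:0,0,1:] * (smult c p - pderiv p)"
  have D: "((\<lambda>x. flat p c (l x + d)) has_derivative (\<lambda>h. l h * flat q c (l x + d))) (at x)" for x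
  proof -
    have "((\<lambda>x. l x + d) has_derivative l) (at x)"
      using has_derivative_add_const[OF bounded_linear_imp_has_derivative[OF l]] .
    from DERIV_compose_FDERIV[OF DERIV_flat[OF c] this] show ?thesis by (simp add: q_def)
  qed
  have "partial_deriv i (\<lambda>x. flat p c (l x + d)) = (\<lambda>x. l (axis i 1) * flat q c (l x + d))" for i
    by (rule ext) (rule partial_deriv_eq[OF D])
  then show ?case
    using D Suc.IH[of q] by (auto simp: differentiable_def intro!: C_k_mult C_k_const)
qed

lemma flat_1_nonneg: "0 \<le> flat 1 c s"
  by (simp add: flat_def)

lemma flat_1_le_1: "0 \<le> c \<Longrightarrow> flat 1 c s \<le> 1"
  by (simp add: flat_def)

lemma flat_1_eq_0_iff: "flat 1 c s = 0 \<longleftrightarrow> s \<le> 0"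
  by (simp add: flat_def not_less)

text \<open>Nonzero exactly on the open box. The rate \<open>c\<close> is kept as a parameter
  because the bump tends to the indicator of the box as c tends to 0; this replaces mollification in
  the uniqueness proof.\<close>

definition box_bump :: "real \<Rightarrow> real ^ 'n \<Rightarrow> real ^ 'n \<Rightarrow> real ^ 'n \<Rightarrow> real" where
  "box_bump c a b x = (\<Prod>i\<in>UNIV. flat 1 c (x $ i - a $ i) * flat 1 c (b $ i - x $ i))"

lemma C_k_box_bump:
  assumes "0 < c"
  shows "C_k k (box_bump c a b)"
proof -
  have 1: "bounded_linear (\<lambda>x::real^'n. x $ i)" for i by (rule bounded_linear_vec_nth)
  have "C_k k (\<lambda>x. flat 1 c (x $ i + (- a $ i)))" for i
    by (rule C_k_flat_comp[OF assms 1])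
  moreover have "C_k k (\<lambda>x. flat 1 c (- (x $ i) + b $ i))" for i
    by (rule C_k_flat_comp[OF assms bounded_linear_minus[OF 1]])
  ultimately show ?thesis
    unfolding box_bump_def by (intro C_k_prod C_k_mult) auto
qed

lemma box_bump_nonneg: "0 \<le> box_bump c a b x"
  and box_bump_le_1: "0 \<le> c \<Longrightarrow> box_bump c a b x \<le> 1"
  unfolding box_bump_def
  by (auto intro!: prod_nonneg prod_le_1 mult_nonneg_nonneg mult_le_one simp: flat_1_nonneg flat_1_le_1)

lemma box_bump_eq_0_iff: "box_bump c a b x = 0 \<longleftrightarrow> x \<notin> box a b"
  by (auto simp: box_bump_def mem_box_cart flat_1_eq_0_iff not_less)

lemma box_bump_test_function:
  assumes "0 < c" "cbox a b \<subseteq> \<Omega>"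
  shows "box_bump c a b \<in> test_functions \<Omega>"
proof -
  have eq: "{x. box_bump c a b x \<noteq> 0} = box a b" by (auto simp: box_bump_eq_0_iff)
  have "closure (box a b) \<subseteq> cbox a b"
    by (rule closure_minimal) (auto simp: mem_box_cart less_imp_le)
  then show ?thesis
    using assms unfolding test_functions_def mem_Collect_eq eq
    by (auto simp: C_k_box_bump compact_eq_bounded_closed intro: bounded_subset[OF bounded_cbox])
qed

lemma box_bump_tendsto:
  "(\<lambda>n. box_bump (1 / real (Suc n)) a b x) \<longlonglongrightarrow> indicator (box a b) x"
proof (cases "x \<in> box a b")
  case True
  have "(\<lambda>n. flat 1 (1 / real (Suc n)) s) \<longlonglongrightarrow> 1" if "0 < s" for s
  proof -
    have "(\<lambda>n. exp (- (1 / real (Suc n)) / s)) \<longlonglongrightarrow> exp (- 0 / s)"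
      using that by (intro tendsto_intros LIMSEQ_Suc[OF lim_1_over_n]) auto
    then show ?thesis using that by (simp add: flat_def)
  qed
  then have "(\<lambda>n. box_bump (1 / real (Suc n)) a b x) \<longlonglongrightarrow> (\<Prod>i\<in>(UNIV::'a set). 1 * 1)"
    unfolding box_bump_def using True by (intro tendsto_prod tendsto_mult) (auto simp: mem_box_cart)
  then show ?thesis using True by simp
next
  case False
  then have "box_bump c a b x = 0" for c by (simp add: box_bump_eq_0_iff)
  then show ?thesis using False by simp
qed

section \<open>Support, bounds and integrals of test functions\<close>

context
  fixes \<Omega> :: "(real ^ 'n) set" and \<phi> :: "real ^ 'n \<Rightarrow> real"
  assumes \<phi>: "\<phi> \<in> test_functions \<Omega>"
begin

lemma test_C_k: "C_k k \<phi>"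
  using \<phi> by (simp add: test_functions_def)

lemma test_continuous: "continuous_on UNIV \<phi>"
  using test_C_k[of 0] by simp

lemma test_differentiable: "\<phi> differentiable (at x)"
  using test_C_k[of "Suc 0"] by simp

lemma test_continuous_partial_deriv: "continuous_on UNIV (partial_deriv i \<phi>)"
  using test_C_k[of "Suc 0"] by simp

lemma test_continuous_grad: "continuous_on UNIV (grad \<phi>)"
  unfolding grad_def by (intro continuous_on_vec_lambda test_continuous_partial_deriv)

lemma test_outside: "x \<notin> \<Omega> \<Longrightarrow> \<phi> x = 0"
  using \<phi> closure_subset[of "{x. \<phi> x \<noteq> 0}"] by (auto simp: test_functions_def)

lemma test_support:
  obtains K where "compact K" "K \<subseteq> \<Omega>" "\<And>x. x \<notin> K \<Longrightarrow> \<phi> x = 0" "\<And>x. x \<notin> K \<Longrightarrow> grad \<phi> x = 0"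
proof -
  define K where "K = closure {x. \<phi> x \<noteq> 0}"
  have K: "compact K" "K \<subseteq> \<Omega>" using \<phi> by (auto simp: test_functions_def K_def)
  have "{x. \<phi> x \<noteq> 0} \<subseteq> K" unfolding K_def by (rule closure_subset)
  then have 0: "\<phi> x = 0" if "x \<notin> K" for x using that by blast
  have 1: "grad \<phi> x = 0" if "x \<notin> K" for x
  proof -
    have "((\<lambda>_. 0) has_derivative (\<lambda>_. 0)) (at x)" by simp
    then have "(\<phi> has_derivative (\<lambda>_. 0)) (at x)"
      by (rule has_derivative_transform_within_open[of _ _ _ _ "- K"])
        (use that 0 K in \<open>auto simp: open_closed compact_imp_closed\<close>)
    from partial_deriv_eq[OF this] show ?thesis by (simp add: vec_eq_iff)
  qed
  show thesis using that[OF K] 0 1 by blast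
qed

lemma test_bounded:
  obtains B where "0 \<le> B" "\<And>x. \<bar>\<phi> x\<bar> \<le> B" "\<And>x. norm (grad \<phi> x) \<le> B"
proof -
  obtain K where K: "compact K" "K \<subseteq> \<Omega>" "\<And>x. x \<notin> K \<Longrightarrow> \<phi> x = 0" "\<And>x. x \<notin> K \<Longrightarrow> grad \<phi> x = 0"
    by (rule test_support) blast
  have "bounded (\<phi> ` K)"
    by (intro compact_imp_bounded compact_continuous_image K(1) continuous_on_subset[OF test_continuous]) simp
  then obtain B where B: "\<And>x. x \<in> K \<Longrightarrow> norm (\<phi> x) \<le> B"
    unfolding bounded_iff by blast
  have "bounded (grad \<phi> ` K)"
    by (intro compact_imp_bounded compact_continuous_image K(1) continuous_on_subset[OF test_continuous_grad]) simp
  then obtain C where C: "\<And>x. x \<in> K \<Longrightarrow> norm (grad \<phi> x) \<le> C"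
    unfolding bounded_iff by blast
  show thesis
  proof (rule that)
    show "0 \<le> max 0 (max B C)" by simp
    show "\<bar>\<phi> x\<bar> \<le> max 0 (max B C)" "norm (grad \<phi> x) \<le> max 0 (max B C)" for x
      using B[of x] C[of x] K(3,4)[of x] by (cases "x \<in> K"; simp add: le_max_iff_disj; blast)+
  qed
qed

end

lemma test_functions_mult:
  assumes "\<phi> \<in> test_functions \<Omega>" "\<And>k. C_k k \<psi>"
  shows "(\<lambda>x. \<phi> x * \<psi> x) \<in> test_functions \<Omega>"
proof -
  have "closure {x. \<phi> x * \<psi> x \<noteq> 0} \<subseteq> closure {x. \<phi> x \<noteq> 0}" by (intro closure_mono) auto
  moreover from this have "bounded (closure {x. \<phi> x * \<psi> x \<noteq> 0})"
    by (rule bounded_subset[rotated]) (use assms in \<open>simp add: test_functions_def compact_imp_bounded\<close>)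
  ultimately show ?thesis
    using assms unfolding test_functions_def mem_Collect_eq compact_eq_bounded_closed
    by (simp add: C_k_mult) blast
qed

lemma test_functions_cmult:
  assumes "\<phi> \<in> test_functions \<Omega>"
  shows "(\<lambda>x. c * \<phi> x) \<in> test_functions \<Omega>"
  using test_functions_mult[OF assms C_k_const[of _ c]] by (simp add: mult.commute)

section \<open>Weak gradients\<close>

lemma integrable_compact_support:
  fixes f :: "real ^ 'n \<Rightarrow> 'b::euclidean_space"
  assumes "compact K" "continuous_on UNIV f" "\<And>x. x \<notin> K \<Longrightarrow> f x = 0"
  shows "integrable lborel f"
proof -
  have "indicator K x *\<^sub>R f x = f x" for x using assms(3)[of x] by (cases "x \<in> K") auto
  then show ?thesis
    using borel_integrable_compact[OF assms(1) continuous_on_subset[OF assms(2)]] by simp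
qed

lemma test_Lipschitz:
  assumes \<phi>: "\<phi> \<in> test_functions \<Omega>" and B: "\<And>x. norm (grad \<phi> x) \<le> B"
  shows "\<bar>\<phi> x - \<phi> y\<bar> \<le> B * norm (x - y)"
proof -
  have "onorm (\<lambda>h. grad \<phi> z \<bullet> h) \<le> B" for z
  proof (rule onorm_le)
    fix h show "norm (grad \<phi> z \<bullet> h) \<le> B * norm h"
      using Cauchy_Schwarz_ineq2[of "grad \<phi> z" h] mult_right_mono[OF B[of z] norm_ge_zero[of h]]
      unfolding real_norm_def by linarith
  qed
  then show ?thesis
    using differentiable_bound[of UNIV \<phi> "\<lambda>z h. grad \<phi> z \<bullet> h" B x y]
      has_derivative_grad[OF test_differentiable[OF \<phi>]] by simp
qed

text \<open>Differentiate \<open>t \<mapsto> \<integral> \<phi> (x + t e\<^sub>i) dx\<close>, which is constant.\<close>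

lemma integral_partial_deriv_test:
  fixes \<phi> :: "real ^ 'n \<Rightarrow> real"
  assumes \<phi>: "\<phi> \<in> test_functions \<Omega>"
  shows "(LINT x|lborel. partial_deriv i \<phi> x) = 0"
proof -
  obtain K where K': "compact K" "K \<subseteq> \<Omega>" "\<And>x. x \<notin> K \<Longrightarrow> \<phi> x = 0" "\<And>x. x \<notin> K \<Longrightarrow> grad \<phi> x = 0"
    by (rule test_support[OF \<phi>]) blast
  note K = K'(1,3)
  obtain B where B': "0 \<le> B" "\<And>x. \<bar>\<phi> x\<bar> \<le> B" "\<And>x. norm (grad \<phi> x) \<le> B"
    by (rule test_bounded[OF \<phi>]) blast
  note B = B'(1,3)
  obtain R where R: "\<And>x. x \<in> K \<Longrightarrow> norm x \<le> R"
    using compact_imp_bounded[OF K(1)] unfolding bounded_iff by blast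
  define e :: "real ^ 'n" where "e = axis i 1"
  have e: "norm e = 1" by (simp add: e_def norm_axis_1)
  define t where "t n = 1 / real (Suc n)" for n
  have t: "0 < t n" "t n \<le> 1" for n by (auto simp: t_def)
  define q where "q n x = (\<phi> (x + t n *\<^sub>R e) - \<phi> x) / t n" for n x
  have int: "integrable lborel \<phi>"
    by (rule integrable_compact_support[OF K(1) test_continuous[OF \<phi>] K(2)])
  have shift: "integrable lborel (\<lambda>x. \<phi> (x + c))" "(LINT x|lborel. \<phi> (x + c)) = (LINT x|lborel. \<phi> x)" for c
    using integrable_distr_eq[of "(+) c" lborel borel \<phi>] integral_distr[of "(+) c" lborel borel \<phi>] int
      borel_measurable_integrable[OF int]
    by (simp_all add: lborel_distr_plus add.commute)
  have "(LINT x|lborel. q n x) = 0" for n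
    unfolding q_def using shift int by simp
  moreover have "(\<lambda>n. LINT x|lborel. q n x) \<longlonglongrightarrow> (LINT x|lborel. partial_deriv i \<phi> x)"
  proof (rule integral_dominated_convergence)
    show "partial_deriv i \<phi> \<in> borel_measurable lborel"
      using test_continuous_partial_deriv[OF \<phi>] by (simp add: borel_measurable_continuous_onI)
    show "q n \<in> borel_measurable lborel" for n
      unfolding q_def
      by (intro borel_measurable_divide borel_measurable_diff borel_measurable_const
          borel_measurable_integrable[OF shift(1)] borel_measurable_integrable[OF int])
    \<comment> \<open>Dominating function: the Lipschitz constant \<open>B\<close> bounds all
      difference quotients, and shifts of length at most 1 keep them supported in this ball.\<close>
    show "integrable lborel (\<lambda>x :: real ^ 'n. B * indicator (cball 0 (R + 1)) x)"
      using emeasure_lborel_cball_finite[of "0 :: real^'n" "R+1"] by (intro integrable_mult_right integrable_real_indicator) auto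
    show "AE x in lborel. (\<lambda>n. q n x) \<longlonglongrightarrow> partial_deriv i \<phi> x"
    proof (rule AE_I2)
      fix x
      have "((\<lambda>s. \<phi> (x + s *\<^sub>R e)) has_derivative (\<lambda>s. grad \<phi> x \<bullet> (s *\<^sub>R e))) (at 0)"
        by (rule has_derivative_compose[of "\<lambda>s. x + s *\<^sub>R e" _ 0 UNIV \<phi>, simplified])
          (auto intro!: derivative_eq_intros has_derivative_grad[OF test_differentiable[OF \<phi>]])
      moreover have "grad \<phi> x \<bullet> e = partial_deriv i \<phi> x"
        by (simp add: e_def inner_axis)
      ultimately have "((\<lambda>s. \<phi> (x + s *\<^sub>R e)) has_real_derivative partial_deriv i \<phi> x) (at 0)"
        by (simp add: has_field_derivative_def mult_commute_abs)
      then have "((\<lambda>h. (\<phi> (x + h *\<^sub>R e) - \<phi> x) / h) \<longlongrightarrow> partial_deriv i \<phi> x) (at 0)"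
        by (simp add: DERIV_def)
      moreover have "filterlim t (at 0) sequentially"
        unfolding filterlim_at
      proof
        show "t \<longlonglongrightarrow> 0" unfolding t_def[abs_def] by (rule LIMSEQ_Suc[OF lim_1_over_n])
        show "\<forall>\<^sub>F n in sequentially. t n \<in> UNIV \<and> t n \<noteq> 0"
          using t(1) by (auto intro!: always_eventually simp: less_le)
      qed
      ultimately show "(\<lambda>n. q n x) \<longlonglongrightarrow> partial_deriv i \<phi> x"
        unfolding q_def by (rule filterlim_compose)
    qed
    show "AE x in lborel. norm (q n x) \<le> B * indicator (cball 0 (R + 1)) x" for n
    proof (rule AE_I2)
      fix x
      show "norm (q n x) \<le> B * indicator (cball 0 (R + 1)) x"
      proof (cases "x \<in> cball 0 (R + 1)")
        case True
        have "\<bar>\<phi> (x + t n *\<^sub>R e) - \<phi> x\<bar> \<le> B * t n"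
          using test_Lipschitz[OF \<phi> B(2), of "x + t n *\<^sub>R e" x] t(1)[of n] e by simp
        then show ?thesis using True t(1)[of n] by (simp add: q_def field_simps)
      next
        case False
        then have "R + 1 < norm x" by simp
        moreover have "norm x \<le> norm (x + t n *\<^sub>R e) + t n"
          using norm_triangle_ineq4[of "x + t n *\<^sub>R e" "t n *\<^sub>R e"] t(1)[of n] e by simp
        ultimately have "x \<notin> K" "x + t n *\<^sub>R e \<notin> K" using R[of x] R[of "x + t n *\<^sub>R e"] t(2)[of n] by linarith+
        then show ?thesis using K(2) False by (simp add: q_def)
      qed
    qed
  qed
  ultimately have "(\<lambda>n::nat. 0 :: real) \<longlonglongrightarrow> (LINT x|lborel. partial_deriv i \<phi> x)" by simp
  then show ?thesis by (simp add: LIMSEQ_const_iff)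
qed

section \<open>Existence, linearity and uniqueness of weak gradients\<close>

lemma open_in_lebesgue: "open \<Omega> \<Longrightarrow> \<Omega> \<in> sets lebesgue"
  by auto

lemma integrable_lebesgue_on_bounded:
  fixes f :: "'a::euclidean_space \<Rightarrow> 'b::{banach,second_countable_topology}"
  assumes "S \<in> lmeasurable" "f \<in> borel_measurable (lebesgue_on S)" "\<And>x. x \<in> S \<Longrightarrow> norm (f x) \<le> B"
  shows "integrable (lebesgue_on S) f"
proof (rule finite_measure.integrable_const_bound[OF finite_measure_lebesgue_on[OF assms(1)] _ assms(2)])
  show "AE x in lebesgue_on S. norm (f x) \<le> B" using assms(3) by (intro AE_I2) simp
qed

lemma integral_lebesgue_on_eq_lborel:
  fixes f :: "'a::euclidean_space \<Rightarrow> real"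
  assumes "f \<in> borel_measurable borel" "\<And>x. x \<notin> \<Omega> \<Longrightarrow> f x = 0" "\<Omega> \<in> sets lebesgue"
  shows "(LINT x|lebesgue_on \<Omega>. f x) = (LINT x|lborel. f x)"
proof -
  have "indicator \<Omega> x *\<^sub>R f x = f x" for x using assms(2)[of x] by (cases "x \<in> \<Omega>") auto
  then have eq: "(\<lambda>x. indicator \<Omega> x *\<^sub>R f x) = f" by (rule ext)
  have "(LINT x|lebesgue_on \<Omega>. f x) = integral\<^sup>L lebesgue (\<lambda>x. indicator \<Omega> x *\<^sub>R f x)"
    by (rule integral_restrict_space) (use assms(3) in simp)
  also have "\<dots> = (LINT x|lborel. f x)"
    unfolding eq by (rule integral_completion) (use assms(1) in simp)
  finally show ?thesis .
qed

lemma locally_integrable_continuous: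
  fixes f :: "real ^ 'n \<Rightarrow> 'b::euclidean_space"
  assumes "continuous_on UNIV f" "\<Omega> \<in> sets lebesgue"
  shows "locally_integrable \<Omega> f"
  unfolding locally_integrable_def
proof (intro conjI allI impI)
  show "f \<in> borel_measurable (lebesgue_on \<Omega>)"
    by (rule continuous_imp_measurable_on_sets_lebesgue[OF continuous_on_subset[OF assms(1)] assms(2)]) simp
  fix K assume K: "compact K \<and> K \<subseteq> \<Omega>"
  have c: "continuous_on K f" using assms(1) by (rule continuous_on_subset) simp
  have "bounded (f ` K)" using K c by (intro compact_imp_bounded compact_continuous_image) simp_all
  then obtain B where "\<And>x. x \<in> K \<Longrightarrow> norm (f x) \<le> B" unfolding bounded_iff by blast
  then show "integrable (lebesgue_on K) f"
    using K c by (intro integrable_lebesgue_on_bounded continuous_imp_measurable_on_sets_lebesgue)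
      (auto simp: lmeasurable_compact fmeasurableD)
qed

text \<open>Integration by parts without boundary terms: a product of two test functions is a test
  function, so the integral of its partial derivative vanishes, and the product rule splits that
  integral.\<close>

lemma has_weak_gradient_test:
  assumes \<phi>: "\<phi> \<in> test_functions \<Omega>" and \<Omega>: "open \<Omega>"
  shows "has_weak_gradient \<Omega> \<phi> (grad \<phi>)"
  unfolding has_weak_gradient_def
proof (intro conjI ballI allI)
  show "locally_integrable \<Omega> \<phi>" "locally_integrable \<Omega> (grad \<phi>)"
    using test_continuous[OF \<phi>] test_continuous_grad[OF \<phi>] \<Omega>
    by (auto intro!: locally_integrable_continuous open_in_lebesgue)
  fix \<psi> i assume \<psi>: "\<psi> \<in> test_functions \<Omega>"
  obtain K where K: "compact K" "K \<subseteq> \<Omega>" "\<And>x. x \<notin> K \<Longrightarrow> \<phi> x = 0" "\<And>x. x \<notin> K \<Longrightarrow> grad \<phi> x = 0"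
    by (rule test_support[OF \<phi>]) blast
  have K4: "partial_deriv i \<phi> x = 0" if "x \<notin> K" for x using K(4)[OF that] by (metis grad_nth zero_index)
  note cont = test_continuous[OF \<phi>] test_continuous[OF \<psi>]
    test_continuous_partial_deriv[OF \<phi>, of i] test_continuous_partial_deriv[OF \<psi>, of i]
  have c1: "continuous_on UNIV (\<lambda>x. \<phi> x * partial_deriv i \<psi> x)"
    and c2: "continuous_on UNIV (\<lambda>x. partial_deriv i \<phi> x * \<psi> x)"
    by (intro continuous_on_mult cont)+
  have int: "integrable lborel (\<lambda>x. \<phi> x * partial_deriv i \<psi> x)"
    "integrable lborel (\<lambda>x. partial_deriv i \<phi> x * \<psi> x)"
    using K(3) K4 by (auto intro!: integrable_compact_support[OF K(1)] c1 c2)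
  have "(\<lambda>x. \<phi> x * \<psi> x) \<in> test_functions \<Omega>"
    using test_functions_mult[OF \<phi>] test_C_k[OF \<psi>] by blast
  from integral_partial_deriv_test[OF this, of i]
  have "(LINT x|lborel. \<phi> x * partial_deriv i \<psi> x) + (LINT x|lborel. partial_deriv i \<phi> x * \<psi> x) = 0"
    using int by (simp add: partial_deriv_mult test_differentiable[OF \<phi>] test_differentiable[OF \<psi>])
  moreover have "(LINT x|lebesgue_on \<Omega>. \<phi> x * partial_deriv i \<psi> x) = (LINT x|lborel. \<phi> x * partial_deriv i \<psi> x)"
    using K c1 \<Omega> by (intro integral_lebesgue_on_eq_lborel borel_measurable_continuous_onI) (auto simp: subset_eq)
  moreover have "(LINT x|lebesgue_on \<Omega>. partial_deriv i \<phi> x * \<psi> x) = (LINT x|lborel. partial_deriv i \<phi> x * \<psi> x)"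
    using K K4 c2 \<Omega> by (intro integral_lebesgue_on_eq_lborel borel_measurable_continuous_onI) (auto simp: subset_eq)
  ultimately show "(LINT x|lebesgue_on \<Omega>. \<phi> x * partial_deriv i \<psi> x) = - (LINT x|lebesgue_on \<Omega>. grad \<phi> x $ i * \<psi> x)"
    by simp
qed

lemma integrable_locally_integrable_mult:
  fixes u \<psi> :: "real ^ 'n \<Rightarrow> real"
  assumes u: "locally_integrable \<Omega> u" and \<Omega>: "\<Omega> \<in> sets lebesgue"
    and K: "compact K" "K \<subseteq> \<Omega>" "\<And>x. x \<notin> K \<Longrightarrow> \<psi> x = 0" and \<psi>: "continuous_on UNIV \<psi>"
  shows "integrable (lebesgue_on \<Omega>) (\<lambda>x. u x * \<psi> x)"
proof -
  have Kl: "K \<in> sets lebesgue" using lmeasurable_compact[OF K(1)] by (rule fmeasurableD)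
  have c: "continuous_on K \<psi>" using \<psi> by (rule continuous_on_subset) simp
  have "bounded (\<psi> ` K)" using K(1) c by (intro compact_imp_bounded compact_continuous_image)
  then obtain B where B: "\<And>x. x \<in> K \<Longrightarrow> \<bar>\<psi> x\<bar> \<le> B" unfolding bounded_iff by auto
  have uK: "integrable (lebesgue_on K) u" using u K by (simp add: locally_integrable_def)
  have "integrable (lebesgue_on K) (\<lambda>x. u x * \<psi> x)"
  proof (rule Bochner_Integration.integrable_bound)
    show "integrable (lebesgue_on K) (\<lambda>x. B * u x)" using uK by simp
    show "(\<lambda>x. u x * \<psi> x) \<in> borel_measurable (lebesgue_on K)"
      by (intro borel_measurable_times borel_measurable_integrable[OF uK]
          continuous_imp_measurable_on_sets_lebesgue c Kl)
    show "AE x in lebesgue_on K. norm (u x * \<psi> x) \<le> norm (B * u x)"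
    proof (rule AE_I2)
      fix x assume "x \<in> space (lebesgue_on K)"
      then have "\<bar>\<psi> x\<bar> \<le> \<bar>B\<bar>" using B[of x] by simp
      then show "norm (u x * \<psi> x) \<le> norm (B * u x)"
        by (simp add: abs_mult mult.commute[of "\<bar>u x\<bar>"] mult_right_mono)
    qed
  qed
  then have "integrable lebesgue (\<lambda>x. indicator K x *\<^sub>R (u x * \<psi> x))"
    using Kl by (subst (asm) integrable_restrict_space) simp_all
  moreover have "(\<lambda>x. indicator K x *\<^sub>R (u x * \<psi> x)) = (\<lambda>x. indicator \<Omega> x *\<^sub>R (u x * \<psi> x))"
    by (rule ext) (use K(3) K(2) in \<open>auto simp: indicator_def\<close>)
  ultimately show ?thesis using \<Omega> by (subst integrable_restrict_space) simp_all
qed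

lemma integrable_locally_integrable_test:
  assumes u: "locally_integrable \<Omega> u" and \<Omega>: "\<Omega> \<in> sets lebesgue" and \<phi>: "\<phi> \<in> test_functions \<Omega>"
  shows "integrable (lebesgue_on \<Omega>) (\<lambda>x. u x * \<phi> x)"
    and "integrable (lebesgue_on \<Omega>) (\<lambda>x. u x * partial_deriv i \<phi> x)"
proof -
  obtain K where K: "compact K" "K \<subseteq> \<Omega>" "\<And>x. x \<notin> K \<Longrightarrow> \<phi> x = 0" "\<And>x. x \<notin> K \<Longrightarrow> grad \<phi> x = 0"
    by (rule test_support[OF \<phi>]) blast
  have K4: "partial_deriv i \<phi> x = 0" if "x \<notin> K" for x using K(4)[OF that] by (metis grad_nth zero_index)
  show "integrable (lebesgue_on \<Omega>) (\<lambda>x. u x * \<phi> x)"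
    by (rule integrable_locally_integrable_mult[OF u \<Omega> K(1,2,3) test_continuous[OF \<phi>]])
  show "integrable (lebesgue_on \<Omega>) (\<lambda>x. u x * partial_deriv i \<phi> x)"
    by (rule integrable_locally_integrable_mult[OF u \<Omega> K(1,2) K4 test_continuous_partial_deriv[OF \<phi>]])
qed

lemma locally_integrable_diff:
  "locally_integrable \<Omega> u \<Longrightarrow> locally_integrable \<Omega> v \<Longrightarrow> locally_integrable \<Omega> (\<lambda>x. u x - v x)"
  unfolding locally_integrable_def by (auto intro: borel_measurable_diff)

lemma locally_integrable_nth:
  fixes v :: "real ^ 'n \<Rightarrow> real ^ 'm"
  assumes "locally_integrable \<Omega> v"
  shows "locally_integrable \<Omega> (\<lambda>x. v x $ i)"
proof -
  have b: "bounded_linear (\<lambda>y :: real ^ 'm. y $ i)" by (rule bounded_linear_vec_nth)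
  then have "(\<lambda>y :: real ^ 'm. y $ i) \<in> borel_measurable borel"
    by (intro borel_measurable_continuous_onI linear_continuous_on)
  note meas = measurable_compose[OF _ this]
  show ?thesis
    unfolding locally_integrable_def
  proof (intro conjI allI impI)
    show "(\<lambda>x. v x $ i) \<in> borel_measurable (lebesgue_on \<Omega>)"
      by (rule meas) (use assms in \<open>simp add: locally_integrable_def\<close>)
    fix K assume "compact K \<and> K \<subseteq> \<Omega>"
    then have "integrable (lebesgue_on K) v" using assms by (simp add: locally_integrable_def)
    then show "integrable (lebesgue_on K) (\<lambda>x. v x $ i)" by (rule integrable_bounded_linear[OF b])
  qed
qed

lemma has_weak_gradient_diff:
  assumes \<Omega>: "\<Omega> \<in> sets lebesgue" and u: "has_weak_gradient \<Omega> u v" "has_weak_gradient \<Omega> u' v'"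
  shows "has_weak_gradient \<Omega> (\<lambda>x. u x - u' x) (\<lambda>x. v x - v' x)"
  unfolding has_weak_gradient_def
proof (intro conjI ballI allI)
  show "locally_integrable \<Omega> (\<lambda>x. u x - u' x)" "locally_integrable \<Omega> (\<lambda>x. v x - v' x)"
    using u by (simp_all add: has_weak_gradient_def locally_integrable_diff)
  fix \<phi> i assume \<phi>: "\<phi> \<in> test_functions \<Omega>"
  have l: "locally_integrable \<Omega> u" "locally_integrable \<Omega> u'"
    "locally_integrable \<Omega> (\<lambda>x. v x $ i)" "locally_integrable \<Omega> (\<lambda>x. v' x $ i)"
    using u by (simp_all add: has_weak_gradient_def locally_integrable_nth)
  have "(LINT x|lebesgue_on \<Omega>. u x * partial_deriv i \<phi> x) = - (LINT x|lebesgue_on \<Omega>. v x $ i * \<phi> x)"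
    "(LINT x|lebesgue_on \<Omega>. u' x * partial_deriv i \<phi> x) = - (LINT x|lebesgue_on \<Omega>. v' x $ i * \<phi> x)"
    using u \<phi> by (simp_all add: has_weak_gradient_def)
  then show "(LINT x|lebesgue_on \<Omega>. (u x - u' x) * partial_deriv i \<phi> x) =
      - (LINT x|lebesgue_on \<Omega>. (v x - v' x) $ i * \<phi> x)"
    by (simp add: left_diff_distrib integrable_locally_integrable_test[OF _ \<Omega> \<phi>] l)
qed

text \<open>Bumps converging to the indicator of a box show that \<open>f\<close> integrates to 0
  over every closed box in \<Omega>. Lebesgue differentiation along small cubes turns this into
  \<open>f = 0\<close> almost everywhere in such a box, and countably many boxes cover
  \<Omega>.\<close>

lemma fundamental_lemma_variations:
  fixes f :: "real ^ 'n \<Rightarrow> real"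
  assumes f: "locally_integrable \<Omega> f" and \<Omega>: "open \<Omega>"
    and 0: "\<And>\<phi>. \<phi> \<in> test_functions \<Omega> \<Longrightarrow> (LINT x|lebesgue_on \<Omega>. f x * \<phi> x) = 0"
  shows "AE x in lebesgue_on \<Omega>. f x = 0"
proof -
  have \<Omega>l: "\<Omega> \<in> sets lebesgue" using \<Omega> by auto
  define F where "F a b x = indicator (cbox a b) x * f x" for a b x
  have int: "integrable lebesgue (F a b)" if "cbox a b \<subseteq> \<Omega>" for a b
  proof -
    have "integrable (lebesgue_on (cbox a b)) f"
      using f that by (simp add: locally_integrable_def)
    then show ?thesis by (subst (asm) integrable_restrict_space) (simp_all add: F_def[abs_def])
  qed
  have box0: "integral (cbox a b) f = 0" if ab: "cbox a b \<subseteq> \<Omega>" for a b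
  proof -
    have ind: "(indicator (box a b) :: real ^ 'n \<Rightarrow> real) \<in> borel_measurable lebesgue"
      by (rule borel_measurable_indicator) simp
    note meas = borel_measurable_times[OF _ borel_measurable_integrable[OF int[OF ab]]]
    have "(\<lambda>n. LINT x|lebesgue. box_bump (1 / real (Suc n)) a b x * F a b x)
       \<longlonglongrightarrow> (LINT x|lebesgue. indicator (box a b) x * F a b x)"
    proof (rule integral_dominated_convergence)
      show "(\<lambda>x. indicator (box a b) x * F a b x) \<in> borel_measurable lebesgue"
        by (rule meas[OF ind])
      show "(\<lambda>x. box_bump (1 / real (Suc n)) a b x * F a b x) \<in> borel_measurable lebesgue" for n
      proof (rule meas)
        have "0 < 1 / real (Suc n)" by simp
        from test_continuous[OF box_bump_test_function[OF this ab]]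
        show "box_bump (1 / real (Suc n)) a b \<in> borel_measurable lebesgue"
          by (intro measurable_completion) (simp add: borel_measurable_continuous_onI)
      qed
      show "integrable lebesgue (\<lambda>x. \<bar>F a b x\<bar>)"
        using int[OF ab] by (rule integrable_abs)
      show "AE x in lebesgue. (\<lambda>n. box_bump (1 / real (Suc n)) a b x * F a b x)
          \<longlonglongrightarrow> indicator (box a b) x * F a b x"
        by (intro AE_I2 tendsto_mult tendsto_const box_bump_tendsto)
      show "AE x in lebesgue. norm (box_bump (1 / real (Suc n)) a b x * F a b x) \<le> \<bar>F a b x\<bar>" for n
        using box_bump_nonneg[of "1 / real (Suc n)" a b] box_bump_le_1[of "1 / real (Suc n)" a b]
        by (intro AE_I2) (simp add: abs_mult mult_left_le_one_le)
    qed
    moreover have "(LINT x|lebesgue. box_bump (1 / real (Suc n)) a b x * F a b x) = 0" for n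
    proof -
      have "(LINT x|lebesgue_on \<Omega>. f x * box_bump (1 / real (Suc n)) a b x) = 0"
        by (rule 0) (rule box_bump_test_function[OF _ ab], simp)
      moreover have "(\<lambda>x. indicator \<Omega> x *\<^sub>R (f x * box_bump (1 / real (Suc n)) a b x)) =
          (\<lambda>x. box_bump (1 / real (Suc n)) a b x * F a b x)"
      proof (rule ext)
        fix x
        show "indicator \<Omega> x *\<^sub>R (f x * box_bump (1 / real (Suc n)) a b x) =
          box_bump (1 / real (Suc n)) a b x * F a b x"
          using ab box_subset_cbox[of a b] box_bump_eq_0_iff[of "1 / real (Suc n)" a b x]
          by (cases "x \<in> box a b") (auto simp: indicator_def subset_eq F_def)
      qed
      ultimately show ?thesis
        using integral_restrict_space[of \<Omega> lebesgue "\<lambda>x. f x * box_bump (1 / real (Suc n)) a b x"] \<Omega>l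
        by (simp only:) simp
    qed
    ultimately have "(\<lambda>n::nat. 0 :: real) \<longlonglongrightarrow> (LINT x|lebesgue. indicator (box a b) x * F a b x)"
      by (simp only:)
    then have *: "(LINT x|lebesgue. indicator (box a b) x * F a b x) = 0"
      by (simp add: LIMSEQ_const_iff)
    \<comment> \<open>The bumps only see the open box; the faces form a null set.\<close>
    have "AE x in lebesgue. x \<notin> cbox a b - box a b"
      using negligible_frontier_interval[of a b] by (intro AE_not_in) (simp add: negligible_iff_null_sets)
    then have "AE x in lebesgue. F a b x = indicator (box a b) x * F a b x"
      by (rule eventually_mono) (auto simp: F_def indicator_def)
    then have "(LINT x|lebesgue. F a b x) = (LINT x|lebesgue. indicator (box a b) x * F a b x)"
      by (intro integral_cong_AE meas[OF ind] borel_measurable_integrable[OF int[OF ab]])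
    with * have "(LINT x|lebesgue. F a b x) = 0" by simp
    then have "(LINT x|lebesgue_on (cbox a b). f x) = 0"
      by (subst integral_restrict_space) (simp_all add: F_def)
    moreover have "integrable (lebesgue_on (cbox a b)) f" using f ab by (simp add: locally_integrable_def)
    ultimately show ?thesis
      using has_integral_integral_lebesgue_on[of "cbox a b" f] by (simp add: integral_unique)
  qed
  have cell: "AE x in lebesgue. x \<in> cbox a b \<longrightarrow> f x = 0" if ab: "cbox a b \<subseteq> \<Omega>" for a b
  proof -
    have "F a b integrable_on UNIV"
      using has_integral_integral_lebesgue_on[of UNIV "F a b"] int[OF ab]
      by (simp add: lebesgue_on_UNIV_eq has_integral_integrable)
    then have "F a b integrable_on cbox c d" for c d by (rule integrable_on_subcbox) simp
    \<comment> \<open>Lebesgue's differentiation theorem for \<open>F a b\<close>, with the averages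
      taken over cubes that have \<open>x\<close> as lower corner.\<close>
    then have "\<exists>N. negligible N \<and> (\<forall>x e. x \<notin> N \<longrightarrow> 0 < e \<longrightarrow> (\<exists>d>0. \<forall>h. 0 < h \<and> h < d \<longrightarrow>
        norm (integral (cbox x (x + h *\<^sub>R One)) (F a b) /\<^sub>R h ^ DIM(real^'n) - F a b x) < e))"
    proof (rule integrable_ccontinuous_explicit, goal_cases)
      case (1 N)
      then show ?case by (intro exI[of _ N] conjI allI impI)
    qed
    then obtain N where N: "negligible N" "\<forall>x e. x \<notin> N \<longrightarrow> 0 < e \<longrightarrow> (\<exists>d>0. \<forall>h. 0 < h \<and> h < d \<longrightarrow>
        norm (integral (cbox x (x + h *\<^sub>R One)) (F a b) /\<^sub>R h ^ DIM(real^'n) - F a b x) < e)"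
      by (elim exE conjE)
    have "f x = 0" if x: "x \<in> box a b" "x \<notin> N" for x
    proof -
      have "\<bar>F a b x\<bar> < e" if e: "0 < e" for e
      proof -
        have "\<exists>d>0. \<forall>h. 0 < h \<and> h < d \<longrightarrow>
          norm (integral (cbox x (x + h *\<^sub>R One)) (F a b) /\<^sub>R h ^ DIM(real^'n) - F a b x) < e"
          using N(2) x(2) e by simp
        then obtain d where d: "0 < d" "\<And>h. 0 < h \<Longrightarrow> h < d \<Longrightarrow>
          norm (integral (cbox x (x + h *\<^sub>R One)) (F a b) /\<^sub>R h ^ DIM(real^'n) - F a b x) < e"
          by blast
        obtain r where r: "0 < r" "cball x r \<subseteq> box a b" using x(1) open_contains_cball_eq[OF open_box] by blast
        \<comment> \<open>Small enough for the differentiation estimate, and for the upper corner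
          \<open>x + h *\<^sub>R One\<close> to stay in the ball inside the box. The average over
          this cube is 0 by \<open>box0\<close>.\<close>
        define h where "h = min (d / 2) (r / (1 + norm (One :: real^'n)))"
        have pos: "0 < 1 + norm (One :: real^'n)" by (simp add: add_pos_nonneg)
        have h: "0 < h" "h < d" "h * (1 + norm (One :: real^'n)) \<le> r"
          using d(1) r(1) pos by (auto simp: h_def pos_le_divide_eq[symmetric])
        have hr: "h * norm (One :: real^'n) \<le> r" using h by (simp add: algebra_simps)
        have "x + h *\<^sub>R One \<in> cball x r" using hr h(1) by (simp add: dist_norm)
        then have "x + h *\<^sub>R One \<in> cbox a b" "x \<in> cbox a b"
          using r(2) x(1) box_subset_cbox[of a b] by auto
        then have sub: "cbox x (x + h *\<^sub>R One) \<subseteq> cbox a b"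
          using interval_subset_is_interval[OF is_interval_cbox] by blast
        have "integral (cbox x (x + h *\<^sub>R One)) (F a b) = integral (cbox x (x + h *\<^sub>R One)) f"
          by (rule integral_cong) (use sub in \<open>auto simp: F_def\<close>)
        also have "\<dots> = 0" using sub ab by (intro box0) auto
        finally show ?thesis using d(2)[OF h(1,2)] by simp
      qed
      then have "F a b x = 0" by (cases "F a b x = 0") (simp, metis less_irrefl zero_less_abs_iff)
      then show ?thesis using x(1) box_subset_cbox[of a b] by (auto simp: F_def)
    qed
    then have "x \<notin> N \<union> (cbox a b - box a b) \<Longrightarrow> x \<in> cbox a b \<longrightarrow> f x = 0" for x by blast
    moreover have "AE x in lebesgue. x \<notin> N \<union> (cbox a b - box a b)"
      using negligible_Un[OF N(1) negligible_frontier_interval[of a b]]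
      by (intro AE_not_in) (simp add: negligible_iff_null_sets)
    ultimately show ?thesis by (elim eventually_mono) blast
  qed
  obtain D where D: "countable D" "D \<subseteq> Pow \<Omega>" "\<And>X. X \<in> D \<Longrightarrow> \<exists>a b. X = cbox a b" "\<Union>D = \<Omega>"
    by (rule open_countable_Union_open_cbox[OF \<Omega>]) blast
  have "AE x in lebesgue. \<forall>X\<in>D. x \<in> X \<longrightarrow> f x = 0"
    unfolding AE_ball_countable[OF D(1)] using D(2,3) cell by blast
  then show ?thesis
    using \<Omega>l D(4) by (subst AE_restrict_space_iff) (auto elim!: eventually_mono)
qed

lemma has_weak_gradient_unique:
  assumes \<Omega>: "open \<Omega>" and v: "has_weak_gradient \<Omega> u v" "has_weak_gradient \<Omega> u v'"
  shows "AE x in lebesgue_on \<Omega>. v x = v' x"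
proof -
  have l: "locally_integrable \<Omega> (\<lambda>x. v x $ i)" "locally_integrable \<Omega> (\<lambda>x. v' x $ i)" for i
    using v by (auto simp: has_weak_gradient_def intro: locally_integrable_nth)
  have "AE x in lebesgue_on \<Omega>. v x $ i - v' x $ i = 0" for i
  proof (rule fundamental_lemma_variations[OF locally_integrable_diff[OF l] \<Omega>])
    fix \<phi> assume \<phi>: "\<phi> \<in> test_functions \<Omega>"
    have "(LINT x|lebesgue_on \<Omega>. v x $ i * \<phi> x) = (LINT x|lebesgue_on \<Omega>. v' x $ i * \<phi> x)"
      using v \<phi> by (auto simp: has_weak_gradient_def)
    then show "(LINT x|lebesgue_on \<Omega>. (v x $ i - v' x $ i) * \<phi> x) = 0"
      using integrable_locally_integrable_test(1)[OF l(1) open_in_lebesgue[OF \<Omega>] \<phi>]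
        integrable_locally_integrable_test(1)[OF l(2) open_in_lebesgue[OF \<Omega>] \<phi>]
      by (simp add: left_diff_distrib)
  qed
  then have "AE x in lebesgue_on \<Omega>. \<forall>i. v x $ i - v' x $ i = 0" by (simp add: AE_all_countable)
  then show ?thesis by (auto elim!: eventually_mono simp: vec_eq_iff)
qed

text \<open>As \<open>weak_gradient\<close> is an unspecified choice, an explicit gradient can
  replace it only almost everywhere, which is enough for modulars.\<close>

lemma weak_gradient_AE_eq:
  assumes "open \<Omega>" "has_weak_gradient \<Omega> u v"
  shows "AE x in lebesgue_on \<Omega>. weak_gradient \<Omega> u x = v x"
  using has_weak_gradient_unique[OF assms(1) someI[of "has_weak_gradient \<Omega> u"] assms(2)] assms(2)
  unfolding weak_gradient_def by blast

section \<open>Morrey's inequality\<close>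

context young
begin

text \<open>Negative numbers are not values of \<open>G\<close>, so \<open>inv_into\<close> is
  unspecified there. Clamping at 0 makes the inverse monotone on the whole line, hence
  Borel.\<close>

lemma borel_measurable_young_inv_max [measurable]:
  "(\<lambda>s. young_inv G (max 0 s)) \<in> borel_measurable borel"
  by (rule borel_measurable_mono) (intro monoI young_inv_mono, auto)

text \<open>\<open>T_int\<close> controls the tail from 1 onwards. A lower limit below 1, which
  occurs for radii above 1, adds only a bounded kernel on \<open>{a..1}\<close>.\<close>

lemma set_integrable_morrey_kernel:
  assumes T: "T_int G n < \<infinity>" and a: "0 < a"
  shows "set_integrable lborel {a..} (\<lambda>s. young_inv G s / s powr (1 + 1 / real n))"
proof -
  define k where "k s = young_inv G s / s powr (1 + 1 / real n)" for s
  have k0: "0 \<le> k s" if "0 \<le> s" for s using young_inv_nonneg[OF that] by (simp add: k_def)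
  have eq: "indicator {a..} s *\<^sub>R k s = indicator {a..} s * (young_inv G (max 0 s) / s powr (1 + 1 / real n))" for s
    using a by (auto simp: indicator_def k_def max_def)
  define M where "M = young_inv G 1 / a powr (1 + 1 / real n)"
  have le: "ennreal (indicator {a..} s *\<^sub>R k s) \<le> ennreal (k s) * indicator {1..} s + ennreal M * indicator {a..1} s" for s
  proof -
    consider "s < a" | "a \<le> s" "1 \<le> s" | "a \<le> s" "s < 1" by linarith
    then show ?thesis
    proof cases
      case 3
      then have "k s \<le> M" unfolding k_def M_def
        using a by (intro frac_le young_inv_mono young_inv_nonneg powr_mono2) auto
      then show ?thesis using 3 by (simp add: ennreal_leI)
    qed auto
  qed
  have "integrable lborel (\<lambda>s. indicator {a..} s *\<^sub>R k s)"
  proof (rule integrableI_nonneg)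
    show "(\<lambda>s. indicator {a..} s *\<^sub>R k s) \<in> borel_measurable lborel"
      unfolding eq by measurable
    show "AE s in lborel. 0 \<le> indicator {a..} s *\<^sub>R k s"
      using k0 a by (intro AE_I2) (auto simp: indicator_def)
    have meas: "(\<lambda>s. ennreal (k s) * indicator {1..} s) \<in> borel_measurable lborel"
    proof -
      have "(\<lambda>s. ennreal (young_inv G (max 0 s) / s powr (1 + 1 / real n)) * indicator {1..} s) \<in> borel_measurable borel"
        by measurable
      also have "(\<lambda>s. ennreal (young_inv G (max 0 s) / s powr (1 + 1 / real n)) * indicator {1..} s) =
          (\<lambda>s. ennreal (k s) * indicator {1..} s)"
        by (auto simp: fun_eq_iff indicator_def k_def max_def)
      finally show ?thesis by simp
    qed
    have "(\<integral>\<^sup>+s. ennreal (indicator {a..} s *\<^sub>R k s) \<partial>lborel) \<le>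
        (\<integral>\<^sup>+s. ennreal (k s) * indicator {1..} s + ennreal M * indicator {a..1} s \<partial>lborel)"
      by (intro nn_integral_mono le)
    also have "\<dots> = T_int G n + ennreal M * emeasure lborel {a..1}"
      using meas by (subst nn_integral_add) (auto simp: T_int_def k_def nn_integral_cmult_indicator)
    also have "\<dots> < \<infinity>"
      using T by (cases "a \<le> 1") (auto simp: ennreal_mult_less_top)
    finally show "(\<integral>\<^sup>+s. ennreal (indicator {a..} s *\<^sub>R k s) \<partial>lborel) < \<infinity>" .
  qed
  then show ?thesis by (simp add: set_integrable_def k_def)
qed

text \<open>The substitution \<open>s = (t r)\<^sup>-\<^sup>n\<close>.\<close>

lemma nn_integral_morrey_sigma:
  assumes T: "T_int G n < \<infinity>" and n: "0 < n" and r: "0 < r"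
  shows "(\<integral>\<^sup>+t. ennreal (indicator {0<..1} t * (real n * r * young_inv G ((t * r) powr - real n))) \<partial>lborel)
    = ennreal (morrey_sigma G n r)"
proof -
  define k where "k s = young_inv G s / s powr (1 + 1 / real n)" for s
  define p where "p t = (t * r) powr - real n" for t
  define p' where "p' t = - real n * r * (t * r) powr (- real n - 1)" for t
  have int: "set_integrable lborel {r powr - real n..} k"
    unfolding k_def using set_integrable_morrey_kernel[OF T, of "r powr - real n"] r by simp
  then have abs: "k absolutely_integrable_on {r powr - real n..}"
    unfolding set_integrable_def
    by (subst integrable_completion) (simp_all add: borel_measurable_integrable)
  have img: "p ` {0<..1} = {r powr - real n..}"
  proof (intro equalityI subsetI)
    fix s assume "s \<in> p ` {0<..1}"
    then obtain t where t: "0 < t" "t \<le> 1" "s = (t * r) powr - real n" by (auto simp: p_def)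
    have "r powr - real n \<le> (t * r) powr - real n"
      using t r n by (intro powr_mono2') (auto simp: mult_le_cancel_right1)
    then show "s \<in> {r powr - real n..}" using t by simp
  next
    fix s assume "s \<in> {r powr - real n..}"
    then have s: "r powr - real n \<le> s" by simp
    then have s0: "0 < s" using r by (intro less_le_trans[OF _ s]) simp
    define t where "t = s powr (- 1 / real n) / r"
    have "(r powr - real n) powr (- 1 / real n) \<ge> s powr (- 1 / real n)"
      using s r n by (intro powr_mono2') auto
    moreover have "(r powr - real n) powr (- 1 / real n) = r" using r n by (simp add: powr_powr)
    ultimately have "t \<le> 1" using r by (simp add: t_def)
    moreover have "0 < t" using s0 r by (simp add: t_def)
    moreover have "p t = s" using r n s0 by (simp add: p_def t_def powr_powr)
    ultimately show "s \<in> p ` {0<..1}" by (intro image_eqI[of _ _ t]) simp_all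
  qed
  have inj: "inj_on p {0<..1}"
  proof (rule inj_onI)
    fix x y assume xy: "x \<in> {0<..1}" "y \<in> {0<..1}" "p x = p y"
    have inv: "(p z) powr (- 1 / real n) = z * r" if "0 < z" for z
      using that r n by (simp add: p_def powr_powr)
    have "x * r = p x powr (- 1 / real n)" using inv[of x] xy(1) by simp
    also have "\<dots> = y * r" unfolding xy(3) using inv[of y] xy(2) by simp
    finally show "x = y" using r by simp
  qed
  have der: "(p has_real_derivative p' t) (at t within {0<..1})" if "t \<in> {0<..1}" for t
  proof -
    have "0 < t * r" using that r by simp
    then have "(p has_real_derivative p' t) (at t)"
      unfolding p_def[abs_def] p'_def by (auto intro!: derivative_eq_intros)
    then show ?thesis
      by (rule has_field_derivative_at_within)
  qed
  have cv: "(\<lambda>t. \<bar>p' t\<bar> * k (p t)) absolutely_integrable_on {0<..1} \<and>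
      integral {0<..1} (\<lambda>t. \<bar>p' t\<bar> * k (p t)) = integral {r powr - real n..} k"
    using has_absolute_integral_change_of_variables_1'[OF _ der inj, of k "integral {r powr - real n..} k"] abs img
    by simp
  \<comment> \<open>The factor \<open>(t * r) powr (- real n - 1)\<close> of the derivative is
    exactly the denominator of the kernel at \<open>p t\<close>, so only \<open>real n * r\<close>
    survives.\<close>
  have eq: "\<bar>p' t\<bar> * k (p t) = real n * r * young_inv G ((t * r) powr - real n)" if "t \<in> {0<..1}" for t
  proof -
    have "(p t) powr (1 + 1 / real n) = (t * r) powr (- real n - 1)"
    proof -
      have "- real n * (1 + 1 / real n) = - real n - 1" using n by (simp add: field_simps)
      then show ?thesis by (simp only: p_def powr_powr)
    qed
    moreover have "0 < (t * r) powr (- real n - 1)" using that r by simp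
    ultimately show ?thesis using that r by (simp add: k_def p'_def abs_mult p_def)
  qed
  have "((\<lambda>t. \<bar>p' t\<bar> * k (p t)) has_integral integral {r powr - real n..} k) {0<..1}"
    using integrable_integral[OF set_lebesgue_integral_eq_integral(1)[OF conjunct1[OF cv]]] cv by simp
  then have "((\<lambda>t. real n * r * young_inv G ((t * r) powr - real n)) has_integral integral {r powr - real n..} k) {0<..1}"
    by (rule has_integral_eq[rotated]) (rule eq)
  moreover have "integral {r powr - real n..} k = morrey_sigma G n r"
    using set_borel_integral_eq_integral(2)[OF int] by (simp add: morrey_sigma_def k_def)
  ultimately show ?thesis
    using r by (intro nn_integral_has_integral_lebesgue) (auto intro!: mult_nonneg_nonneg young_inv_nonneg)
qed

text \<open>In the substituted form the integrand on (0,1] is smallest at t = 1, where it is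
  positive.\<close>

lemma morrey_sigma_pos:
  assumes T: "T_int G n < \<infinity>" and n: "0 < n" and r: "0 < r"
  shows "0 < morrey_sigma G n r"
proof -
  define c where "c = real n * r * young_inv G (r powr - real n)"
  have c: "0 < c" using n r by (simp add: c_def young_inv_pos)
  have "ennreal c = (\<integral>\<^sup>+t. ennreal c * indicator {0<..1::real} t \<partial>lborel)"
    by (subst nn_integral_cmult_indicator) simp_all
  also have "\<dots> \<le> (\<integral>\<^sup>+t. ennreal (indicator {0<..1} t * (real n * r * young_inv G ((t * r) powr - real n))) \<partial>lborel)"
  proof (rule nn_integral_mono)
    fix t :: real
    have "c \<le> real n * r * young_inv G ((t * r) powr - real n)" if "0 < t" "t \<le> 1"
      unfolding c_def using that r n
      by (intro mult_left_mono young_inv_mono powr_mono2') (auto simp: mult_le_cancel_right1)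
    then show "ennreal c * indicator {0<..1} t \<le> ennreal (indicator {0<..1} t * (real n * r * young_inv G ((t * r) powr - real n)))"
      by (auto simp: indicator_def ennreal_leI)
  qed
  also have "\<dots> = ennreal (morrey_sigma G n r)" by (rule nn_integral_morrey_sigma[OF assms])
  finally have "ennreal c \<le> ennreal (morrey_sigma G n r)" .
  then show ?thesis using c by (smt (verit) ennreal_le_iff2)
qed

text \<open>Jensen's inequality, through the tangent of \<open>G\<close> at \<open>G\<^sup>-\<^sup>1 (1 / m)\<close>.\<close>

lemma Jensen_mass_1:
  fixes f :: "'a \<Rightarrow> real"
  assumes [measurable]: "f \<in> borel_measurable M" "Q \<in> sets M" and f: "\<And>x. 0 \<le> f x"
    and m: "emeasure M Q = ennreal m" "0 < m"
    and G: "(\<integral>\<^sup>+x. ennreal (G (f x)) \<partial>M) \<le> 1"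
  shows "(\<integral>\<^sup>+x. ennreal (f x) * indicator Q x \<partial>M) \<le> ennreal (m * young_inv G (1 / m))"
proof -
  define a where "a = young_inv G (1 / m)"
  have a: "0 < a" "G a = 1 / m" using m by (auto simp: a_def young_inv_pos G_young_inv)
  have ga: "0 < g a" using a g_pos by simp
  have [measurable]: "(\<lambda>x. G (f x)) \<in> borel_measurable M"
    using borel_measurable_G_norm[of f M] f by simp
  \<comment> \<open>The tangent inequality at \<open>a\<close>, with \<open>G a = 1 / m\<close> and
    the negative term moved across, because subtraction in \<open>ennreal\<close> is
    truncated.\<close>
  have pt: "ennreal (g a) * (ennreal (f x) * indicator Q x) + ennreal (1 / m) * indicator Q x
      \<le> ennreal (a * g a) * indicator Q x + ennreal (G (f x))" for x
  proof (cases "x \<in> Q")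
    case True
    have "g a * f x + 1 / m \<le> a * g a + G (f x)"
      using tangent_le[of a "f x"] a f[of x] by (simp add: algebra_simps)
    then show ?thesis using True f[of x] ga a m(2) G_nonneg[OF f[of x]]
      by (simp add: ennreal_mult[symmetric] ennreal_plus[symmetric] ennreal_leI del: ennreal_plus)
  qed simp
  define I where "I = (\<integral>\<^sup>+x. ennreal (f x) * indicator Q x \<partial>M)"
  have "(\<integral>\<^sup>+x. ennreal (g a) * (ennreal (f x) * indicator Q x) + ennreal (1 / m) * indicator Q x \<partial>M)
      \<le> (\<integral>\<^sup>+x. ennreal (a * g a) * indicator Q x + ennreal (G (f x)) \<partial>M)"
    by (intro nn_integral_mono pt)
  then have "ennreal (g a) * I + ennreal (1 / m) * ennreal m \<le> ennreal (a * g a) * ennreal m + (\<integral>\<^sup>+x. ennreal (G (f x)) \<partial>M)"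
    by (simp add: nn_integral_add nn_integral_cmult nn_integral_cmult_indicator I_def m)
  also have "\<dots> \<le> ennreal (a * g a) * ennreal m + 1" using G by (intro add_left_mono)
  also have "ennreal (1 / m) * ennreal m = 1"
    using m(2) by (simp add: ennreal_mult[symmetric])
  finally have "ennreal (g a) * I + 1 \<le> ennreal (a * g a) * ennreal m + 1" .
  \<comment> \<open>The constant 1/m integrates to 1 over \<open>Q\<close>, which matches the bound
    1 on the modular; the two finite terms cancel.\<close>
  then have "1 + ennreal (g a) * I \<le> 1 + ennreal (g a) * ennreal (m * a)"
    using a ga m(2) by (simp add: ennreal_mult[symmetric] add.commute mult_ac)
  then have "ennreal (g a) * I \<le> ennreal (g a) * ennreal (m * a)"
    by (simp add: ennreal_add_left_cancel_le)
  then have "I \<le> ennreal (m * a)" using ga by (simp add: ennreal_mult_le_mult_iff)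
  then show ?thesis by (simp add: I_def a_def)
qed

end

section \<open>Geometry behind Morrey's inequality, and Luxemburg norms\<close>

lemma test_segment_bound:
  fixes \<phi> :: "real ^ 'n \<Rightarrow> real"
  assumes \<phi>: "\<phi> \<in> test_functions \<Omega>"
  shows "ennreal \<bar>\<phi> y - \<phi> x\<bar> \<le>
    (\<integral>\<^sup>+t. ennreal (indicator {0..1} t * (norm (grad \<phi> (x + t *\<^sub>R (y - x))) * norm (y - x))) \<partial>lborel)"
proof -
  let ?d = "\<lambda>t. grad \<phi> (x + t *\<^sub>R (y - x)) \<bullet> (y - x)"
  let ?b = "\<lambda>t. norm (grad \<phi> (x + t *\<^sub>R (y - x))) * norm (y - x)"
  have der: "((\<lambda>t. \<phi> (x + t *\<^sub>R (y - x))) has_vector_derivative ?d t) (at t within {0..1})" for t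
  proof -
    have "((\<lambda>t. \<phi> (x + t *\<^sub>R (y - x))) has_derivative (\<lambda>s. grad \<phi> (x + t *\<^sub>R (y - x)) \<bullet> (s *\<^sub>R (y - x)))) (at t within {0..1})"
      by (rule has_derivative_compose[OF _ has_derivative_grad[OF test_differentiable[OF \<phi>]]])
        (auto intro!: derivative_eq_intros)
    then show ?thesis by (simp add: has_vector_derivative_def)
  qed
  have 1: "(?d has_integral (\<phi> y - \<phi> x)) {0..1}"
    using fundamental_theorem_of_calculus[OF _ der] by simp
  have "continuous_on {0..1::real} ?b"
    by (intro continuous_intros continuous_on_compose2[OF test_continuous_grad[OF \<phi>]]) auto
  then have 2: "(?b has_integral integral {0..1} ?b) {0..1}"
    by (intro integrable_integral integrable_continuous_interval)
  have "\<bar>integral {0..1} ?d\<bar> \<le> integral {0..1} ?b"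
    using integral_norm_bound_integral[OF has_integral_integrable[OF 1] has_integral_integrable[OF 2]]
    by (simp add: Cauchy_Schwarz_ineq2)
  then have "ennreal \<bar>\<phi> y - \<phi> x\<bar> \<le> ennreal (integral {0..1} ?b)"
    using integral_unique[OF 1] by (simp add: ennreal_leI)
  also have "\<dots> = (\<integral>\<^sup>+t. ennreal (indicator {0..1} t * ?b t) \<partial>lborel)"
    by (rule nn_integral_has_integral_lebesgue[OF _ 2, symmetric]) simp
  finally show ?thesis .
qed

lemma emeasure_cube:
  fixes a :: "'a::euclidean_space"
  assumes "0 \<le> r"
  shows "emeasure lborel (cbox a (a + r *\<^sub>R One)) = ennreal (r ^ DIM('a))"
  using assms by (subst emeasure_lborel_cbox) (auto simp: inner_add_left inner_diff_left)

text \<open>The homothety with centre \<open>x\<close> and ratio \<open>t\<close> maps the cube of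
  side \<open>r\<close> onto one of side \<open>t * r\<close>; the Jacobian is
  \<open>t ^ DIM('a)\<close>.\<close>

lemma nn_integral_cube_homothety:
  fixes h :: "'a::euclidean_space \<Rightarrow> ennreal"
  assumes h [measurable]: "h \<in> borel_measurable borel" and t: "0 < t"
  shows "ennreal (t ^ DIM('a)) * (\<integral>\<^sup>+y. h (x + t *\<^sub>R (y - x)) * indicator (cbox a (a + r *\<^sub>R One)) y \<partial>lborel)
    = (\<integral>\<^sup>+z. h z * indicator (cbox ((1 - t) *\<^sub>R x + t *\<^sub>R a) ((1 - t) *\<^sub>R x + t *\<^sub>R a + (t * r) *\<^sub>R One)) z \<partial>lborel)"
proof -
  let ?Q = "cbox a (a + r *\<^sub>R One)"
  let ?s = "(1 - t) *\<^sub>R x"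
  let ?Qt = "cbox (?s + t *\<^sub>R a) (?s + t *\<^sub>R a + (t * r) *\<^sub>R One)"
  have Q: "?s + t *\<^sub>R y \<in> ?Qt \<longleftrightarrow> y \<in> ?Q" for y
  proof -
    have 1: "t * (a \<bullet> i) \<le> t * (y \<bullet> i) \<longleftrightarrow> a \<bullet> i \<le> y \<bullet> i" for i using t by simp
    have 2: "t * (y \<bullet> i) \<le> t * (a \<bullet> i) + t * r \<longleftrightarrow> y \<bullet> i \<le> a \<bullet> i + r" for i
      using t by (simp flip: distrib_left)
    show ?thesis by (simp add: mem_box inner_add_left 1 2)
  qed
  have "(\<integral>\<^sup>+z. h z * indicator ?Qt z \<partial>lborel) =
      (\<integral>\<^sup>+z. h z * indicator ?Qt z \<partial>density (distr lborel borel (\<lambda>y. ?s + t *\<^sub>R y)) (\<lambda>_. ennreal (\<bar>t\<bar> ^ DIM('a))))"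
    by (subst lborel_affine[of t ?s]) (use t in simp_all)
  also have "\<dots> = (\<integral>\<^sup>+y. ennreal (\<bar>t\<bar> ^ DIM('a)) * (h (?s + t *\<^sub>R y) * indicator ?Qt (?s + t *\<^sub>R y)) \<partial>lborel)"
    by (simp add: nn_integral_density nn_integral_distr)
  also have "\<dots> = (\<integral>\<^sup>+y. ennreal (t ^ DIM('a)) * (h (x + t *\<^sub>R (y - x)) * indicator ?Q y) \<partial>lborel)"
  proof (rule nn_integral_cong)
    fix y
    have "?s + t *\<^sub>R y = x + t *\<^sub>R (y - x)" by (simp add: algebra_simps)
    moreover have "indicator ?Qt (?s + t *\<^sub>R y) = (indicator ?Q y :: ennreal)"
      by (simp add: indicator_def Q del: scaleR_left_diff_distrib)
    ultimately show "ennreal (\<bar>t\<bar> ^ DIM('a)) * (h (?s + t *\<^sub>R y) * indicator ?Qt (?s + t *\<^sub>R y)) =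
        ennreal (t ^ DIM('a)) * (h (x + t *\<^sub>R (y - x)) * indicator ?Q y)" using t by simp
  qed
  also have "\<dots> = ennreal (t ^ DIM('a)) * (\<integral>\<^sup>+y. h (x + t *\<^sub>R (y - x)) * indicator ?Q y \<partial>lborel)"
    by (rule nn_integral_cmult) measurable
  finally show ?thesis ..
qed

lemma modular_cong_AE:
  "AE x in lebesgue_on \<Omega>. \<bar>u x\<bar> = \<bar>v x\<bar> \<Longrightarrow> modular G \<Omega> u = modular G \<Omega> v"
  unfolding modular_def by (intro nn_integral_cong_AE) (auto elim!: eventually_mono)

text \<open>The witness \<open>c\<close> makes the set under the infimum nonempty; without it the
  real \<open>Inf\<close> would give no information.\<close>

lemma luxemburg_norm_nonneg:
  assumes "0 < c" "modular G \<Omega> (\<lambda>x. u x / c) \<le> 1"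
  shows "0 \<le> luxemburg_norm G \<Omega> u"
  unfolding luxemburg_norm_def using assms by (intro cInf_greatest) auto

lemma luxemburg_norm_lessE:
  assumes "0 < c" "modular G \<Omega> (\<lambda>x. u x / c) \<le> 1" "luxemburg_norm G \<Omega> u < \<epsilon>"
  obtains a where "0 < a" "a < \<epsilon>" "modular G \<Omega> (\<lambda>x. u x / a) \<le> 1"
proof -
  have "{\<delta>. \<delta> > 0 \<and> modular G \<Omega> (\<lambda>x. u x / \<delta>) \<le> 1} \<noteq> {}" using assms(1,2) by blast
  from cInf_lessD[OF this] assms(3) show thesis
    unfolding luxemburg_norm_def using that by blast
qed

text \<open>A nonempty bounded set has a nonempty closed frontier, so the distance is attained
  there, and openness puts the minimizer outside \<Omega>. Boundedness also makes the supremum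
  defining \<open>inner_radius\<close> an upper bound.\<close>

lemma inner_radius_boundary_point:
  fixes \<Omega> :: "(real ^ 'n) set"
  assumes \<Omega>: "bounded \<Omega>" "open \<Omega>" and x: "x \<in> \<Omega>"
  obtains z where "z \<notin> \<Omega>" "dist x z \<le> inner_radius \<Omega>" "0 < inner_radius \<Omega>"
proof -
  have ne: "frontier \<Omega> \<noteq> {}"
    using x \<Omega>(1) not_bounded_UNIV by (auto simp: frontier_eq_empty)
  have bdd: "bdd_above ((\<lambda>x. infdist x (frontier \<Omega>)) ` \<Omega>)"
  proof -
    obtain z where z: "z \<in> frontier \<Omega>" using ne by blast
    obtain B where B: "\<forall>y\<in>\<Omega>. dist z y \<le> B" using \<Omega>(1) bounded_any_center[of \<Omega> z] by blast
    show ?thesis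
      by (rule bdd_aboveI2[of _ _ B]) (use B infdist_le[OF z] in \<open>force simp: dist_commute intro: order_trans\<close>)
  qed
  obtain z where z: "z \<in> frontier \<Omega>" "infdist x (frontier \<Omega>) = dist x z"
    using infdist_attains_inf[OF frontier_closed ne] by blast
  have zn: "z \<notin> \<Omega>" using z(1) \<Omega>(2) by (simp add: frontier_def interior_open)
  have le: "dist x z \<le> inner_radius \<Omega>"
    unfolding inner_radius_def z(2)[symmetric] using x bdd by (rule cSUP_upper)
  have "0 < dist x z" using x zn by auto
  then have "0 < inner_radius \<Omega>" using le by linarith
  with zn le show thesis by (rule that)
qed

context young
begin

lemma morrey_cube_average:
  fixes \<phi> :: "real ^ 'n \<Rightarrow> real"
  assumes T: "T_int G CARD('n) < \<infinity>" and \<phi>: "\<phi> \<in> test_functions \<Omega>"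
    and \<delta>: "0 < \<delta>" and G1: "(\<integral>\<^sup>+x. ennreal (G (norm (grad \<phi> x) / \<delta>)) \<partial>lborel) \<le> 1"
    and r: "0 < r" and x: "x \<in> cbox a (a + r *\<^sub>R One)"
  shows "(\<integral>\<^sup>+y. ennreal \<bar>\<phi> y - \<phi> x\<bar> * indicator (cbox a (a + r *\<^sub>R One)) y \<partial>lborel)
    \<le> ennreal (r ^ CARD('n) * \<delta> * morrey_sigma G CARD('n) r)"
proof -
  define n where "n = CARD('n)"
  have n: "0 < n" by (simp add: n_def)
  let ?Q = "cbox a (a + r *\<^sub>R One)"
  define N where "N z = norm (grad \<phi> z)" for z
  have N0: "0 \<le> N z" for z by (simp add: N_def)
  have [measurable]: "N \<in> borel_measurable borel"
    unfolding N_def[abs_def] using test_continuous_grad[OF \<phi>]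
    by (intro borel_measurable_continuous_onI continuous_on_norm)
  define K where "K y t = ennreal (indicator {0..1} t * (N (x + t *\<^sub>R (y - x)) * (real n * r))) * indicator ?Q y" for y t
  \<comment> \<open>The l1 bound on the diameter is coarser than the Euclidean one, but its factor
    \<open>real n * r\<close> is the one that the substitution in \<open>morrey_sigma\<close>
    requires.\<close>
  have diam: "norm (y - x) \<le> real n * r" if "y \<in> ?Q" for y
  proof -
    have "norm (y - x) \<le> (\<Sum>b\<in>Basis. \<bar>(y - x) \<bullet> b\<bar>)" by (rule norm_le_l1)
    also have "\<dots> \<le> (\<Sum>b\<in>(Basis :: (real ^ 'n) set). r)"
    proof (rule sum_mono)
      fix b :: "real ^ 'n" assume b: "b \<in> Basis"
      then have "a \<bullet> b \<le> y \<bullet> b" "y \<bullet> b \<le> a \<bullet> b + r" "a \<bullet> b \<le> x \<bullet> b" "x \<bullet> b \<le> a \<bullet> b + r"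
        using that x by (auto simp: mem_box inner_add_left)
      then show "\<bar>(y - x) \<bullet> b\<bar> \<le> r" by (simp add: inner_diff_left abs_le_iff)
    qed
    also have "\<dots> = real n * r" by (simp add: n_def)
    finally show ?thesis .
  qed
  have "(\<integral>\<^sup>+y. ennreal \<bar>\<phi> y - \<phi> x\<bar> * indicator ?Q y \<partial>lborel) \<le> (\<integral>\<^sup>+y. (\<integral>\<^sup>+t. K y t \<partial>lborel) \<partial>lborel)"
  proof (rule nn_integral_mono)
    fix y
    show "ennreal \<bar>\<phi> y - \<phi> x\<bar> * indicator ?Q y \<le> (\<integral>\<^sup>+t. K y t \<partial>lborel)"
    proof (cases "y \<in> ?Q")
      case True
      have "ennreal \<bar>\<phi> y - \<phi> x\<bar> \<le> (\<integral>\<^sup>+t. ennreal (indicator {0..1} t * (N (x + t *\<^sub>R (y - x)) * norm (y - x))) \<partial>lborel)"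
        unfolding N_def by (rule test_segment_bound[OF \<phi>])
      also have "\<dots> \<le> (\<integral>\<^sup>+t. ennreal (indicator {0..1} t * (N (x + t *\<^sub>R (y - x)) * (real n * r))) \<partial>lborel)"
        using N0 diam[OF True] by (intro nn_integral_mono ennreal_leI mult_left_mono) auto
      finally show ?thesis using True by (simp add: K_def)
    qed simp
  qed
  also have "\<dots> = (\<integral>\<^sup>+t. (\<integral>\<^sup>+y. K y t \<partial>lborel) \<partial>lborel)"
    by (rule lborel_pair.Fubini'[symmetric]) (unfold K_def, measurable)
  also have "\<dots> \<le> (\<integral>\<^sup>+t. ennreal (r ^ n * \<delta>) *
      ennreal (indicator {0<..1} t * (real n * r * young_inv G ((t * r) powr - real n))) \<partial>lborel)"
  \<comment> \<open>At \<open>t = 0\<close> the homothety degenerates; this point is null.\<close>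
  proof (rule nn_integral_mono_AE)
    have "(\<integral>\<^sup>+y. K y t \<partial>lborel) \<le> ennreal (r ^ n * \<delta>) *
        ennreal (indicator {0<..1} t * (real n * r * young_inv G ((t * r) powr - real n)))" if "t \<noteq> 0" for t
    proof (cases "t \<in> {0<..1}")
      case False
      then have "K y t = 0" for y using that by (auto simp: K_def)
      then show ?thesis by simp
    next
      case True
      then have t: "0 < t" "t \<le> 1" by auto
      define I where "I = (\<integral>\<^sup>+y. ennreal (N (x + t *\<^sub>R (y - x))) * indicator ?Q y \<partial>lborel)"
      define m where "m = (t * r) ^ n"
      have m: "0 < m" using t r by (simp add: m_def)
      define b where "b = young_inv G ((t * r) powr - real n)"
      have b: "0 \<le> b" by (simp add: b_def young_inv_nonneg)
      have bm: "young_inv G (1 / m) = b"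
        using t r by (simp add: b_def m_def powr_minus powr_realpow divide_inverse)
      let ?c = "(1 - t) *\<^sub>R x + t *\<^sub>R a"
      let ?Qt = "cbox ?c (?c + (t * r) *\<^sub>R One)"
      have "ennreal (t ^ n) * I = (\<integral>\<^sup>+z. ennreal (N z) * indicator ?Qt z \<partial>lborel)"
        unfolding I_def using nn_integral_cube_homothety[of "\<lambda>z. ennreal (N z)" t x a r] t by (simp add: n_def)
      also have "\<dots> = (\<integral>\<^sup>+z. ennreal \<delta> * (ennreal (N z / \<delta>) * indicator ?Qt z) \<partial>lborel)"
        using \<delta> N0 by (intro nn_integral_cong) (simp add: ennreal_mult[symmetric] mult.assoc[symmetric])
      also have "\<dots> = ennreal \<delta> * (\<integral>\<^sup>+z. ennreal (N z / \<delta>) * indicator ?Qt z \<partial>lborel)"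
        by (rule nn_integral_cmult) measurable
      also have "\<dots> \<le> ennreal \<delta> * ennreal (m * b)"
      proof (rule mult_left_mono)
        show "(\<integral>\<^sup>+z. ennreal (N z / \<delta>) * indicator ?Qt z \<partial>lborel) \<le> ennreal (m * b)"
          unfolding bm[symmetric]
        proof (rule Jensen_mass_1)
          show "emeasure lborel ?Qt = ennreal m"
            using emeasure_cube[of "t * r" ?c] t r by (simp add: m_def n_def)
          show "(\<integral>\<^sup>+z. ennreal (G (N z / \<delta>)) \<partial>lborel) \<le> 1" using G1 by (simp add: N_def)
        qed (use m \<delta> N0 in auto)
      qed simp
      \<comment> \<open>The measure \<open>m\<close> contains the Jacobian \<open>t ^ n\<close>,
        which cancels and leaves a factor \<open>r ^ n\<close> independent of
        \<open>t\<close>.\<close>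
      also have "\<dots> = ennreal (t ^ n) * ennreal (r ^ n * \<delta> * b)"
        using \<delta> b m t r by (simp add: ennreal_mult[symmetric] m_def power_mult_distrib mult_ac)
      finally have I: "I \<le> ennreal (r ^ n * \<delta> * b)"
        using t by (simp add: ennreal_mult_le_mult_iff)
      have "(\<integral>\<^sup>+y. K y t \<partial>lborel) = (\<integral>\<^sup>+y. ennreal (real n * r) * (ennreal (N (x + t *\<^sub>R (y - x))) * indicator ?Q y) \<partial>lborel)"
        using t N0 r by (intro nn_integral_cong) (simp add: K_def ennreal_mult mult_ac)
      also have "\<dots> = ennreal (real n * r) * I"
        unfolding I_def by (rule nn_integral_cmult) measurable
      also have "\<dots> \<le> ennreal (real n * r) * ennreal (r ^ n * \<delta> * b)"
        using I by (rule mult_left_mono) simp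
      also have "\<dots> = ennreal (r ^ n * \<delta>) * ennreal (indicator {0<..1} t * (real n * r * b))"
        using True \<delta> b r by (simp add: ennreal_mult[symmetric] mult_ac)
      finally show ?thesis by (simp add: b_def)
    qed
    then show "AE t in lborel. (\<integral>\<^sup>+y. K y t \<partial>lborel) \<le> ennreal (r ^ n * \<delta>) *
        ennreal (indicator {0<..1} t * (real n * r * young_inv G ((t * r) powr - real n)))"
      using AE_lborel_singleton[of "0::real"] by (auto elim!: eventually_mono)
  qed
  also have "\<dots> = ennreal (r ^ n * \<delta>) * ennreal (morrey_sigma G n r)"
  proof -
    have [measurable]: "(\<lambda>t. young_inv G ((t * r) powr - real n)) \<in> borel_measurable borel"
    proof -
      have "(\<lambda>t. young_inv G (max 0 ((t * r) powr - real n))) \<in> borel_measurable borel"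
        by measurable
      then show ?thesis by simp
    qed
    show ?thesis
      using nn_integral_morrey_sigma[OF T[folded n_def] n r] by (subst nn_integral_cmult) auto
  qed
  also have "\<dots> = ennreal (r ^ n * \<delta> * morrey_sigma G n r)"
    using r \<delta> morrey_sigma_pos[OF T[folded n_def] n r] by (simp add: ennreal_mult[symmetric])
  finally show ?thesis by (simp add: n_def)
qed

lemma morrey_test:
  fixes \<phi> :: "real ^ 'n \<Rightarrow> real"
  assumes T: "T_int G CARD('n) < \<infinity>" and \<phi>: "\<phi> \<in> test_functions \<Omega>"
    and \<delta>: "0 < \<delta>" and G1: "(\<integral>\<^sup>+x. ennreal (G (norm (grad \<phi> x) / \<delta>)) \<partial>lborel) \<le> 1"
    and r: "0 < r" "dist x z \<le> r" and z: "\<phi> z = 0"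
  shows "\<bar>\<phi> x\<bar> \<le> 2 * \<delta> * morrey_sigma G CARD('n) r"
proof -
  define n where "n = CARD('n)"
  \<comment> \<open>With the coordinatewise minimum as lower corner, the cube of side
    \<open>r\<close> contains both points, since no coordinate difference exceeds
    \<open>dist x z\<close>.\<close>
  define a :: "real ^ 'n" where "a = (\<Sum>b\<in>Basis. min (x \<bullet> b) (z \<bullet> b) *\<^sub>R b)"
  have ab: "a \<bullet> b = min (x \<bullet> b) (z \<bullet> b)" if "b \<in> Basis" for b
    using that by (simp add: a_def)
  let ?Q = "cbox a (a + r *\<^sub>R One)"
  let ?I = "\<lambda>x. \<integral>\<^sup>+y. ennreal \<bar>\<phi> y - \<phi> x\<bar> * indicator ?Q y \<partial>lborel"
  let ?S = "r ^ n * \<delta> * morrey_sigma G n r"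
  have "\<bar>x \<bullet> b - z \<bullet> b\<bar> \<le> r" if "b \<in> Basis" for b
    using Basis_le_norm[OF that, of "x - z"] r(2) by (simp add: dist_norm inner_diff_left)
  then have xz: "x \<in> ?Q" "z \<in> ?Q"
    by (force simp: mem_box ab inner_add_left min_def)+
  have [measurable]: "\<phi> \<in> borel_measurable borel"
    using test_continuous[OF \<phi>] by (rule borel_measurable_continuous_onI)
  have S: "0 \<le> ?S" using r \<delta> morrey_sigma_pos[OF T _ r(1)] by (simp add: n_def)
  \<comment> \<open>Since \<open>\<phi> z = 0\<close>, the value at \<open>x\<close> is bounded by
    its deviation from \<open>\<phi> y\<close> plus that at \<open>z\<close>; this is integrated
    over \<open>y\<close> in the common cube.\<close>
  have "ennreal (\<bar>\<phi> x\<bar> * r ^ n) = (\<integral>\<^sup>+y. ennreal \<bar>\<phi> x\<bar> * indicator ?Q y \<partial>lborel)"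
    using r(1) emeasure_cube[of r a] by (simp add: nn_integral_cmult_indicator ennreal_mult n_def)
  also have "\<dots> \<le> (\<integral>\<^sup>+y. ennreal \<bar>\<phi> y - \<phi> x\<bar> * indicator ?Q y + ennreal \<bar>\<phi> y - \<phi> z\<bar> * indicator ?Q y \<partial>lborel)"
  proof (rule nn_integral_mono)
    fix y
    have "\<bar>\<phi> x\<bar> \<le> \<bar>\<phi> y - \<phi> x\<bar> + \<bar>\<phi> y - \<phi> z\<bar>" using z by simp
    then have "ennreal \<bar>\<phi> x\<bar> \<le> ennreal \<bar>\<phi> y - \<phi> x\<bar> + ennreal \<bar>\<phi> y - \<phi> z\<bar>"
      by (simp add: ennreal_leI ennreal_plus[symmetric] del: ennreal_plus)
    then show "ennreal \<bar>\<phi> x\<bar> * indicator ?Q y \<le> ennreal \<bar>\<phi> y - \<phi> x\<bar> * indicator ?Q y + ennreal \<bar>\<phi> y - \<phi> z\<bar> * indicator ?Q y"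
      by (simp add: indicator_def)
  qed
  also have "\<dots> = ?I x + ?I z" by (rule nn_integral_add) measurable
  also have "\<dots> \<le> ennreal ?S + ennreal ?S"
    unfolding n_def by (intro add_mono morrey_cube_average[OF T \<phi> \<delta> G1 r(1)] xz)
  also have "\<dots> = ennreal (2 * ?S)" using S by (simp add: ennreal_plus[symmetric] mult_ac del: ennreal_plus)
  finally have "\<bar>\<phi> x\<bar> * r ^ n \<le> 2 * ?S" using S by (simp add: ennreal_le_iff)
  then have "\<bar>\<phi> x\<bar> * r ^ n \<le> (2 * \<delta> * morrey_sigma G n r) * r ^ n" by (simp add: mult_ac)
  then show ?thesis using r(1) by (simp add: n_def)
qed

text \<open>The cube may be larger than the distance to the boundary, so its side is taken to be the
  inner radius for every \<open>x\<close> and no monotonicity of \<sigma> is needed.\<close>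

lemma morrey_test_inner_radius:
  fixes \<phi> :: "real ^ 'n \<Rightarrow> real"
  assumes T: "T_int G CARD('n) < \<infinity>" and \<Omega>: "bounded \<Omega>" "open \<Omega>" and \<phi>: "\<phi> \<in> test_functions \<Omega>"
    and \<delta>: "0 < \<delta>" and G1: "modular G \<Omega> (\<lambda>x. norm (grad \<phi> x) / \<delta>) \<le> 1" and x: "x \<in> \<Omega>"
  shows "\<bar>\<phi> x\<bar> \<le> 2 * \<delta> * morrey_sigma G CARD('n) (inner_radius \<Omega>)"
proof -
  obtain z where z: "z \<notin> \<Omega>" "dist x z \<le> inner_radius \<Omega>" "0 < inner_radius \<Omega>"
    by (rule inner_radius_boundary_point[OF \<Omega> x])
  obtain K where K: "compact K" "K \<subseteq> \<Omega>" "\<And>x. x \<notin> K \<Longrightarrow> \<phi> x = 0" "\<And>x. x \<notin> K \<Longrightarrow> grad \<phi> x = 0"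
    by (rule test_support[OF \<phi>]) blast
  have out: "grad \<phi> x = 0" if "x \<notin> \<Omega>" for x using K(4)[of x] K(2) that by blast
  have "(\<integral>\<^sup>+x. ennreal (G (norm (grad \<phi> x) / \<delta>)) \<partial>lborel) =
      (\<integral>\<^sup>+x. ennreal (G \<bar>norm (grad \<phi> x) / \<delta>\<bar>) * indicator \<Omega> x \<partial>lebesgue)"
    unfolding nn_integral_completion
  proof (rule nn_integral_cong)
    fix x
    show "ennreal (G (norm (grad \<phi> x) / \<delta>)) = ennreal (G \<bar>norm (grad \<phi> x) / \<delta>\<bar>) * indicator \<Omega> x"
      using out[of x] \<delta> by (cases "x \<in> \<Omega>") auto
  qed
  also have "\<dots> = modular G \<Omega> (\<lambda>x. norm (grad \<phi> x) / \<delta>)"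
    unfolding modular_def using \<Omega>(2) by (subst nn_integral_restrict_space) auto
  finally have G1': "(\<integral>\<^sup>+x. ennreal (G (norm (grad \<phi> x) / \<delta>)) \<partial>lborel) \<le> 1" using G1 by simp
  show ?thesis by (rule morrey_test[OF T \<phi> \<delta> G1' z(3,2) test_outside[OF \<phi> z(1)]])
qed

text \<open>Triangle inequality for Luxemburg norms, stated for levels: convexity with weights
  a/(a+b) and b/(a+b). The pointwise hypothesis, instead of a sum, covers norms of gradients as
  well.\<close>

lemma modular_triangle:
  assumes ab: "0 < a" "0 < b"
    and [measurable]: "f1 \<in> borel_measurable (lebesgue_on \<Omega>)" "f2 \<in> borel_measurable (lebesgue_on \<Omega>)"
    and m: "modular G \<Omega> (\<lambda>x. f1 x / a) \<le> 1" "modular G \<Omega> (\<lambda>x. f2 x / b) \<le> 1"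
    and le: "AE x in lebesgue_on \<Omega>. \<bar>f x\<bar> \<le> \<bar>f1 x\<bar> + \<bar>f2 x\<bar>"
  shows "modular G \<Omega> (\<lambda>x. f x / (a + b)) \<le> 1"
proof -
  define s where "s = a / (a + b)"
  define t where "t = b / (a + b)"
  have st: "0 \<le> s" "0 \<le> t" "s + t = 1" using ab by (auto simp: s_def t_def add_divide_distrib[symmetric])
  have pt: "ennreal (G \<bar>f x / (a + b)\<bar>) \<le> ennreal s * ennreal (G \<bar>f1 x / a\<bar>) + ennreal t * ennreal (G \<bar>f2 x / b\<bar>)"
    if "\<bar>f x\<bar> \<le> \<bar>f1 x\<bar> + \<bar>f2 x\<bar>" for x
  proof -
    have "\<bar>f x / (a + b)\<bar> \<le> (\<bar>f1 x\<bar> + \<bar>f2 x\<bar>) / (a + b)"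
      using that ab by (simp add: abs_divide divide_right_mono)
    also have "\<dots> = s * \<bar>f1 x / a\<bar> + t * \<bar>f2 x / b\<bar>"
      using ab by (simp add: s_def t_def add_divide_distrib)
    finally have "G \<bar>f x / (a + b)\<bar> \<le> G (s * \<bar>f1 x / a\<bar> + t * \<bar>f2 x / b\<bar>)"
      by (intro mono_G) auto
    also have "\<dots> \<le> s * G \<bar>f1 x / a\<bar> + t * G \<bar>f2 x / b\<bar>"
    proof -
      have s: "s = 1 - t" using st by simp
      show ?thesis
        using convex_onD[OF convex_G, of t "\<bar>f1 x / a\<bar>" "\<bar>f2 x / b\<bar>"] st unfolding s by simp
    qed
    finally show ?thesis
      using st G_nonneg by (simp add: ennreal_mult[symmetric] ennreal_plus[symmetric] ennreal_leI del: ennreal_plus)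
  qed
  have "modular G \<Omega> (\<lambda>x. f x / (a + b)) \<le>
      (\<integral>\<^sup>+x. ennreal s * ennreal (G \<bar>f1 x / a\<bar>) + ennreal t * ennreal (G \<bar>f2 x / b\<bar>) \<partial>lebesgue_on \<Omega>)"
    unfolding modular_def by (intro nn_integral_mono_AE eventually_mono[OF le] pt)
  also have "\<dots> = ennreal s * modular G \<Omega> (\<lambda>x. f1 x / a) + ennreal t * modular G \<Omega> (\<lambda>x. f2 x / b)"
    unfolding modular_def by (simp add: nn_integral_add nn_integral_cmult del: abs_divide)
  also have "\<dots> \<le> ennreal s * 1 + ennreal t * 1"
    by (intro add_mono mult_left_mono m) auto
  also have "\<dots> = 1" using st by (simp add: ennreal_plus[symmetric] del: ennreal_plus)
  finally show ?thesis .
qed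

text \<open>Provides the levels that make Luxemburg norms meaningful: dividing by
  \<open>max 1 m\<close>, with \<open>m\<close> the modular, divides the modular at least as much by
  convexity.\<close>

lemma orlicz_space_modular_le_1:
  assumes u: "u \<in> orlicz_space G \<Omega>"
  obtains a where "0 < a" "modular G \<Omega> (\<lambda>x. u x / a) \<le> 1"
proof -
  have [measurable]: "u \<in> borel_measurable (lebesgue_on \<Omega>)" and fin: "modular G \<Omega> u < \<infinity>"
    using u by (auto simp: orlicz_space_def)
  obtain m where m: "0 \<le> m" "modular G \<Omega> u = ennreal m"
    using fin by (cases "modular G \<Omega> u") auto
  define a where "a = max 1 m"
  have a: "1 \<le> a" "m \<le> a" by (auto simp: a_def)
  have "modular G \<Omega> (\<lambda>x. u x / a) \<le> (\<integral>\<^sup>+x. ennreal (1 / a) * ennreal (G \<bar>u x\<bar>) \<partial>lebesgue_on \<Omega>)"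
    unfolding modular_def
  proof (rule nn_integral_mono)
    fix x
    have "G \<bar>u x / a\<bar> \<le> 1 / a * G \<bar>u x\<bar>"
      using scale_le[of "1 / a" "\<bar>u x\<bar>"] a by simp
    then show "ennreal (G \<bar>u x / a\<bar>) \<le> ennreal (1 / a) * ennreal (G \<bar>u x\<bar>)"
      using a G_nonneg[of "\<bar>u x\<bar>"] by (simp add: ennreal_mult[symmetric] ennreal_leI)
  qed
  also have "\<dots> = ennreal (1 / a) * modular G \<Omega> u"
    unfolding modular_def by (rule nn_integral_cmult) measurable
  also have "\<dots> = ennreal (m / a)" using m a by (simp add: ennreal_mult[symmetric])
  also have "\<dots> \<le> 1" using a m by simp
  finally show thesis using a by (intro that[of a]) auto
qed

lemma bounded_orlicz_space:
  assumes \<Omega>: "bounded \<Omega>" "\<Omega> \<in> sets lebesgue" and u: "u \<in> borel_measurable (lebesgue_on \<Omega>)"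
    and B: "\<And>x. \<bar>u x\<bar> \<le> B"
  shows "u \<in> orlicz_space G \<Omega>"
proof -
  have "modular G \<Omega> u \<le> (\<integral>\<^sup>+x. ennreal (G B) \<partial>lebesgue_on \<Omega>)"
    unfolding modular_def by (intro nn_integral_mono ennreal_leI mono_G B) simp
  also have "\<dots> < \<infinity>"
    using bounded_set_imp_lmeasurable[OF \<Omega>] \<Omega>(2)
    by (simp add: emeasure_restrict_space ennreal_mult_less_top fmeasurable_def)
  finally show ?thesis using u by (simp add: orlicz_space_def)
qed

lemma test_orlicz_space:
  assumes \<Omega>: "bounded \<Omega>" "open \<Omega>" and \<phi>: "\<phi> \<in> test_functions \<Omega>"
  shows "\<phi> \<in> orlicz_space G \<Omega>" "(\<lambda>x. norm (grad \<phi> x)) \<in> orlicz_space G \<Omega>"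
    "\<phi> \<in> borel_measurable (lebesgue_on \<Omega>)" "(\<lambda>x. norm (grad \<phi> x)) \<in> borel_measurable (lebesgue_on \<Omega>)"
proof -
  obtain B where B: "0 \<le> B" "\<And>x. \<bar>\<phi> x\<bar> \<le> B" "\<And>x. norm (grad \<phi> x) \<le> B"
    by (rule test_bounded[OF \<phi>]) blast
  have l: "\<Omega> \<in> sets lebesgue" using \<Omega>(2) by auto
  show m: "\<phi> \<in> borel_measurable (lebesgue_on \<Omega>)" "(\<lambda>x. norm (grad \<phi> x)) \<in> borel_measurable (lebesgue_on \<Omega>)"
    by (intro continuous_imp_measurable_on_sets_lebesgue l continuous_on_norm
        continuous_on_subset[OF test_continuous[OF \<phi>]] continuous_on_subset[OF test_continuous_grad[OF \<phi>]]; simp)+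
  show "\<phi> \<in> orlicz_space G \<Omega>" "(\<lambda>x. norm (grad \<phi> x)) \<in> orlicz_space G \<Omega>"
    using bounded_orlicz_space[OF \<Omega>(1) l m(1) B(2)] bounded_orlicz_space[OF \<Omega>(1) l m(2), of B] B(3) by simp_all
qed

end

lemma has_weak_gradient_weak_gradient:
  "has_weak_gradient \<Omega> u v \<Longrightarrow> has_weak_gradient \<Omega> u (weak_gradient \<Omega> u)"
  unfolding weak_gradient_def by (rule someI[of "has_weak_gradient \<Omega> u"])

lemma has_weak_gradient_measurable:
  assumes "has_weak_gradient \<Omega> u v"
  shows "(\<lambda>x. norm (v x)) \<in> borel_measurable (lebesgue_on \<Omega>)"
proof -
  have "v \<in> borel_measurable (lebesgue_on \<Omega>)"
    using assms by (simp add: has_weak_gradient_def locally_integrable_def)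
  then show ?thesis by measurable
qed

context young
begin

text \<open>Convergence \<open>\<phi> \<rightarrow> u\<close> is only used in measure, through Chebyshev's inequality for the modular.\<close>

lemma orlicz_sobolev_0_bound:
  fixes u :: "real ^ 'n \<Rightarrow> real"
  assumes T: "T_int G CARD('n) < \<infinity>" and \<Omega>: "bounded \<Omega>" "open \<Omega>" "\<Omega> \<noteq> {}"
    and u: "u \<in> orlicz_sobolev_0 G \<Omega>"
    and \<delta>: "0 < \<delta>" and G1: "modular G \<Omega> (\<lambda>x. norm (weak_gradient \<Omega> u x) / \<delta>) \<le> 1"
  shows "AE x in lebesgue_on \<Omega>. \<bar>u x\<bar> \<le> 2 * \<delta> * morrey_sigma G CARD('n) (inner_radius \<Omega>)"
proof -
  have \<Omega>l: "\<Omega> \<in> sets lebesgue" using \<Omega> by auto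
  obtain x0 where "x0 \<in> \<Omega>" using \<Omega> by auto
  then obtain z where "0 < inner_radius \<Omega>" by (rule inner_radius_boundary_point[OF \<Omega>(1,2)])
  define \<sigma> where "\<sigma> = morrey_sigma G CARD('n) (inner_radius \<Omega>)"
  have \<sigma>: "0 < \<sigma>" unfolding \<sigma>_def by (rule morrey_sigma_pos[OF T _ \<open>0 < inner_radius \<Omega>\<close>]) simp
  define v where "v = weak_gradient \<Omega> u"
  have uo: "u \<in> orlicz_space G \<Omega>" and vo: "(\<lambda>x. norm (v x)) \<in> orlicz_space G \<Omega>"
    and ex: "\<exists>v. has_weak_gradient \<Omega> u v"
    using u by (simp_all add: orlicz_sobolev_0_def orlicz_sobolev_def v_def)
  from ex obtain v' where "has_weak_gradient \<Omega> u v'" ..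
  then have uv: "has_weak_gradient \<Omega> u v"
    unfolding v_def by (rule has_weak_gradient_weak_gradient)
  have um [measurable]: "u \<in> borel_measurable (lebesgue_on \<Omega>)" using uo by (simp add: orlicz_space_def)
  \<comment> \<open>Here \<open>|\<phi>|\<close> is at most
    \<open>2 * \<delta> * \<sigma> + \<eta>\<close>, so \<open>|u - \<phi>|\<close> exceeds \<eta>
    on this set, whose measure Chebyshev's inequality bounds.\<close>
  have key: "emeasure (lebesgue_on \<Omega>) {x \<in> \<Omega>. 2 * \<delta> * \<sigma> + 2 * \<eta> < \<bar>u x\<bar>} \<le> ennreal (\<epsilon> / \<eta>)"
    if \<eta>: "0 < \<eta>" and \<epsilon>: "0 < \<epsilon>" "\<epsilon> \<le> \<eta>" "2 * \<epsilon> * \<sigma> \<le> \<eta>" for \<eta> \<epsilon>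
  proof -
    obtain \<phi> where \<phi>: "\<phi> \<in> test_functions \<Omega>" "sobolev_norm G \<Omega> (\<lambda>x. u x - \<phi> x) < \<epsilon>"
      using u \<epsilon>(1) unfolding orlicz_sobolev_0_def by blast
    note t = test_orlicz_space[OF \<Omega>(1,2) \<phi>(1)]
    define d where "d x = u x - \<phi> x" for x
    define vd where "vd = weak_gradient \<Omega> d"
    have hd: "has_weak_gradient \<Omega> d (\<lambda>x. v x - grad \<phi> x)"
      unfolding d_def by (rule has_weak_gradient_diff[OF \<Omega>l uv has_weak_gradient_test[OF \<phi>(1) \<Omega>(2)]])
    then have hvd: "has_weak_gradient \<Omega> d vd" unfolding vd_def by (rule has_weak_gradient_weak_gradient)
    have vd: "AE x in lebesgue_on \<Omega>. vd x = v x - grad \<phi> x"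
      unfolding vd_def by (rule weak_gradient_AE_eq[OF \<Omega>(2) hd])
    have vm: "(\<lambda>x. norm (v x)) \<in> borel_measurable (lebesgue_on \<Omega>)"
      and vdm: "(\<lambda>x. norm (vd x)) \<in> borel_measurable (lebesgue_on \<Omega>)"
      using has_weak_gradient_measurable uv hvd by auto
    have [measurable]: "d \<in> borel_measurable (lebesgue_on \<Omega>)"
      unfolding d_def[abs_def] using um t(3) by (rule borel_measurable_diff)
    \<comment> \<open>These four levels serve only to show that the sets defining the two Luxemburg
      norms of the difference are nonempty.\<close>
    obtain a1 where a1: "0 < a1" "modular G \<Omega> (\<lambda>x. u x / a1) \<le> 1" by (rule orlicz_space_modular_le_1[OF uo])
    obtain a2 where a2: "0 < a2" "modular G \<Omega> (\<lambda>x. \<phi> x / a2) \<le> 1" by (rule orlicz_space_modular_le_1[OF t(1)])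
    obtain b1 where b1: "0 < b1" "modular G \<Omega> (\<lambda>x. norm (v x) / b1) \<le> 1" by (rule orlicz_space_modular_le_1[OF vo])
    obtain b2 where b2: "0 < b2" "modular G \<Omega> (\<lambda>x. norm (grad \<phi> x) / b2) \<le> 1" by (rule orlicz_space_modular_le_1[OF t(2)])
    have m1: "modular G \<Omega> (\<lambda>x. d x / (a1 + a2)) \<le> 1"
      by (rule modular_triangle[OF a1(1) a2(1) um t(3) a1(2) a2(2)]) (simp add: d_def)
    have le1: "AE x in lebesgue_on \<Omega>. \<bar>norm (vd x)\<bar> \<le> \<bar>norm (v x)\<bar> + \<bar>norm (grad \<phi> x)\<bar>"
      using vd by (rule eventually_mono) (simp add: norm_triangle_ineq4)
    have m2: "modular G \<Omega> (\<lambda>x. norm (vd x) / (b1 + b2)) \<le> 1"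
      by (rule modular_triangle[OF b1(1) b2(1) vm t(4) b1(2) b2(2) le1])
    have "0 < a1 + a2" "0 < b1 + b2" using a1 a2 b1 b2 by auto
    have n1: "0 \<le> luxemburg_norm G \<Omega> d" by (rule luxemburg_norm_nonneg[OF \<open>0 < a1 + a2\<close> m1])
    have n2: "0 \<le> luxemburg_norm G \<Omega> (\<lambda>x. norm (vd x))" by (rule luxemburg_norm_nonneg[OF \<open>0 < b1 + b2\<close> m2])
    have "luxemburg_norm G \<Omega> d + luxemburg_norm G \<Omega> (\<lambda>x. norm (vd x)) < \<epsilon>"
      using \<phi>(2) by (simp add: sobolev_norm_def vd_def d_def[abs_def])
    then have n3: "luxemburg_norm G \<Omega> d < \<epsilon>" "luxemburg_norm G \<Omega> (\<lambda>x. norm (vd x)) < \<epsilon>" using n1 n2 by auto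
    obtain a where a: "0 < a" "a < \<epsilon>" "modular G \<Omega> (\<lambda>x. d x / a) \<le> 1"
      by (rule luxemburg_norm_lessE[OF \<open>0 < a1 + a2\<close> m1 n3(1)])
    obtain b where b: "0 < b" "b < \<epsilon>" "modular G \<Omega> (\<lambda>x. norm (vd x) / b) \<le> 1"
      by (rule luxemburg_norm_lessE[OF \<open>0 < b1 + b2\<close> m2 n3(2)])
    \<comment> \<open>The gradient of \<open>\<phi>\<close> is \<open>v - vd\<close>, so its modular
      is at most 1 at level \<open>\<delta> + b\<close> with \<open>b < \<epsilon>\<close>; Morrey's
      bound for \<open>\<phi>\<close> worsens by at most \<eta>.\<close>
    have le2: "AE x in lebesgue_on \<Omega>. \<bar>norm (grad \<phi> x)\<bar> \<le> \<bar>norm (v x)\<bar> + \<bar>norm (vd x)\<bar>"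
      using vd
    proof (rule eventually_mono)
      fix x assume "vd x = v x - grad \<phi> x"
      then have "grad \<phi> x = v x - vd x" by simp
      then show "\<bar>norm (grad \<phi> x)\<bar> \<le> \<bar>norm (v x)\<bar> + \<bar>norm (vd x)\<bar>" by (simp add: norm_triangle_ineq4)
    qed
    have m3: "modular G \<Omega> (\<lambda>x. norm (grad \<phi> x) / (\<delta> + b)) \<le> 1"
      by (rule modular_triangle[OF \<delta> b(1) vm vdm G1[folded v_def] b(3) le2])
    have \<phi>b: "\<bar>\<phi> x\<bar> \<le> 2 * \<delta> * \<sigma> + \<eta>" if "x \<in> \<Omega>" for x
    proof -
      have "\<bar>\<phi> x\<bar> \<le> 2 * (\<delta> + b) * \<sigma>"
        unfolding \<sigma>_def using morrey_test_inner_radius[OF T \<Omega>(1,2) \<phi>(1) _ m3 that] \<delta> b(1) by simp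
      moreover have "2 * b * \<sigma> \<le> 2 * \<epsilon> * \<sigma>" using b \<sigma> by simp
      ultimately show ?thesis using \<epsilon>(3) by (simp add: algebra_simps)
    qed
    define S where "S = {x \<in> \<Omega>. 2 * \<delta> * \<sigma> + 2 * \<eta> < \<bar>u x\<bar>}"
    have S: "S \<in> sets (lebesgue_on \<Omega>)"
    proof -
      have "{x \<in> space (lebesgue_on \<Omega>). 2 * \<delta> * \<sigma> + 2 * \<eta> < \<bar>u x\<bar>} \<in> sets (lebesgue_on \<Omega>)" by measurable
      then show ?thesis by (simp add: S_def)
    qed
    have G\<eta>: "\<eta> / \<epsilon> \<le> G \<bar>d x / a\<bar>" if "x \<in> S" for x
    proof -
      have "\<eta> \<le> \<bar>d x\<bar>" using that \<phi>b[of x] by (auto simp: S_def d_def)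
      then have "\<eta> / \<epsilon> \<le> \<bar>d x / a\<bar>" using a \<epsilon> \<eta> by (simp add: frac_le)
      moreover have "1 \<le> \<eta> / \<epsilon>" using \<epsilon> by simp
      ultimately show ?thesis using G_ge[of "\<bar>d x / a\<bar>"] by linarith
    qed
    have "ennreal (\<eta> / \<epsilon>) * emeasure (lebesgue_on \<Omega>) S = (\<integral>\<^sup>+x. ennreal (\<eta> / \<epsilon>) * indicator S x \<partial>lebesgue_on \<Omega>)"
      using S by (simp add: nn_integral_cmult_indicator)
    also have "\<dots> \<le> modular G \<Omega> (\<lambda>x. d x / a)"
      unfolding modular_def using G\<eta> by (intro nn_integral_mono) (simp add: indicator_def ennreal_leI)
    also have "\<dots> \<le> 1" by (rule a(3))
    finally have "ennreal (\<epsilon> / \<eta>) * (ennreal (\<eta> / \<epsilon>) * emeasure (lebesgue_on \<Omega>) S) \<le> ennreal (\<epsilon> / \<eta>) * 1"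
      by (rule mult_left_mono) simp
    moreover have "ennreal (\<epsilon> / \<eta>) * ennreal (\<eta> / \<epsilon>) = 1" using \<epsilon> \<eta> by (simp add: ennreal_mult[symmetric])
    ultimately show ?thesis by (simp add: S_def mult.assoc[symmetric])
  qed
  have null: "emeasure (lebesgue_on \<Omega>) {x \<in> \<Omega>. 2 * \<delta> * \<sigma> + 2 * \<eta> < \<bar>u x\<bar>} = 0" if \<eta>: "0 < \<eta>" for \<eta>
  proof -
    define c where "c = min \<eta> (\<eta> / (2 * \<sigma>))"
    have c: "0 < c" "c \<le> \<eta>" "2 * c * \<sigma> \<le> \<eta>"
    proof -
      show "0 < c" "c \<le> \<eta>" using \<eta> \<sigma> by (auto simp: c_def)
      have "c \<le> \<eta> / (2 * \<sigma>)" by (simp add: c_def)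
      then show "2 * c * \<sigma> \<le> \<eta>" using \<sigma> by (simp add: pos_le_divide_eq mult_ac)
    qed
    let ?e = "emeasure (lebesgue_on \<Omega>) {x \<in> \<Omega>. 2 * \<delta> * \<sigma> + 2 * \<eta> < \<bar>u x\<bar>}"
    have "?e \<noteq> \<infinity>" using key[OF \<eta> c] by (auto simp: top_unique)
    then obtain m where m: "0 \<le> m" "?e = ennreal m" by (cases ?e) auto
    have "m \<le> 0"
    proof (rule ccontr)
      assume "\<not> m \<le> 0"
      \<comment> \<open>The second entry forces \<open>\<epsilon> / \<eta> \<le> m / 2\<close>, so
        that \<open>key\<close> would bound the measure \<open>m\<close> by half of itself.\<close>
      define \<epsilon> where "\<epsilon> = min c (m * \<eta> / 2)"
      have \<epsilon>: "0 < \<epsilon>" "\<epsilon> \<le> c" "\<epsilon> \<le> m * \<eta> / 2" using c \<eta> \<open>\<not> m \<le> 0\<close> by (auto simp: \<epsilon>_def)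
      have "2 * \<epsilon> * \<sigma> \<le> 2 * c * \<sigma>" using \<epsilon> \<sigma> by simp
      then have "ennreal m \<le> ennreal (\<epsilon> / \<eta>)" using key[OF \<eta>, of \<epsilon>] \<epsilon> c m by simp
      then have "m \<le> \<epsilon> / \<eta>" using \<epsilon> \<eta> by (simp add: ennreal_le_iff)
      also have "\<dots> \<le> m / 2" using \<epsilon>(3) \<eta> by (simp add: pos_divide_le_eq)
      finally show False using \<open>\<not> m \<le> 0\<close> by simp
    qed
    then show ?thesis using m by simp
  qed
  have "AE x in lebesgue_on \<Omega>. \<bar>u x\<bar> \<le> 2 * \<delta> * \<sigma> + 2 * (1 / real (Suc k))" for k
  proof (rule AE_I)
    show "{x \<in> space (lebesgue_on \<Omega>). \<not> \<bar>u x\<bar> \<le> 2 * \<delta> * \<sigma> + 2 * (1 / real (Suc k))}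
      \<subseteq> {x \<in> \<Omega>. 2 * \<delta> * \<sigma> + 2 * (1 / real (Suc k)) < \<bar>u x\<bar>}" by auto
    show "emeasure (lebesgue_on \<Omega>) {x \<in> \<Omega>. 2 * \<delta> * \<sigma> + 2 * (1 / real (Suc k)) < \<bar>u x\<bar>} = 0"
      by (rule null) simp
    have "{x \<in> space (lebesgue_on \<Omega>). 2 * \<delta> * \<sigma> + 2 * (1 / real (Suc k)) < \<bar>u x\<bar>} \<in> sets (lebesgue_on \<Omega>)" by measurable
    then show "{x \<in> \<Omega>. 2 * \<delta> * \<sigma> + 2 * (1 / real (Suc k)) < \<bar>u x\<bar>} \<in> sets (lebesgue_on \<Omega>)" by simp
  qed
  then have "AE x in lebesgue_on \<Omega>. \<forall>k. \<bar>u x\<bar> \<le> 2 * \<delta> * \<sigma> + 2 * (1 / real (Suc k))"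
    by (simp only: AE_all_countable) blast
  then show ?thesis
    unfolding \<sigma>_def[symmetric]
  proof (rule eventually_mono)
    fix x assume *: "\<forall>k. \<bar>u x\<bar> \<le> 2 * \<delta> * \<sigma> + 2 * (1 / real (Suc k))"
    have "(\<lambda>k. 2 * \<delta> * \<sigma> + 2 * (1 / real (Suc k))) \<longlonglongrightarrow> 2 * \<delta> * \<sigma> + 2 * 0"
      by (intro tendsto_intros LIMSEQ_Suc[OF lim_1_over_n])
    then show "\<bar>u x\<bar> \<le> 2 * \<delta> * \<sigma>" using * by (intro LIMSEQ_le_const[of _ "2 * \<delta> * \<sigma>"]) auto
  qed
qed

text \<open>The function approximates itself. The chosen weak gradient of the zero difference is
  zero only almost everywhere, yet every positive level is then admissible in the Luxemburg
  norm.\<close>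

lemma test_orlicz_sobolev_0:
  assumes \<Omega>: "bounded \<Omega>" "open \<Omega>" and \<phi>: "\<phi> \<in> test_functions \<Omega>"
  shows "\<phi> \<in> orlicz_sobolev_0 G \<Omega>"
proof -
  have \<Omega>l: "\<Omega> \<in> sets lebesgue" using \<Omega> by auto
  note t = test_orlicz_space[OF \<Omega> \<phi>]
  have h: "has_weak_gradient \<Omega> \<phi> (grad \<phi>)" by (rule has_weak_gradient_test[OF \<phi> \<Omega>(2)])
  have "AE x in lebesgue_on \<Omega>. \<bar>norm (weak_gradient \<Omega> \<phi> x)\<bar> = \<bar>norm (grad \<phi> x)\<bar>"
    using weak_gradient_AE_eq[OF \<Omega>(2) h] by (rule eventually_mono) simp
  then have "modular G \<Omega> (\<lambda>x. norm (weak_gradient \<Omega> \<phi> x)) = modular G \<Omega> (\<lambda>x. norm (grad \<phi> x))"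
    by (rule modular_cong_AE)
  then have "(\<lambda>x. norm (weak_gradient \<Omega> \<phi> x)) \<in> orlicz_space G \<Omega>"
    using t(2) has_weak_gradient_measurable[OF has_weak_gradient_weak_gradient[OF h]]
    by (simp add: orlicz_space_def)
  then have s: "\<phi> \<in> orlicz_sobolev G \<Omega>" using t(1) h unfolding orlicz_sobolev_def by blast
  have "has_weak_gradient \<Omega> (\<lambda>x. \<phi> x - \<phi> x) (\<lambda>x. grad \<phi> x - grad \<phi> x)"
    by (rule has_weak_gradient_diff[OF \<Omega>l h h])
  from weak_gradient_AE_eq[OF \<Omega>(2) this]
  have wg: "AE x in lebesgue_on \<Omega>. norm (weak_gradient \<Omega> (\<lambda>x. \<phi> x - \<phi> x) x) = 0"
    by (rule eventually_mono) simp
  have lux: "luxemburg_norm G \<Omega> f \<le> c" if f: "AE x in lebesgue_on \<Omega>. f x = 0" and c: "0 < c" for c f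
  proof -
    have "modular G \<Omega> (\<lambda>x. f x / c) = modular G \<Omega> (\<lambda>x. 0)"
      by (rule modular_cong_AE) (rule eventually_mono[OF f], simp)
    then have "modular G \<Omega> (\<lambda>x. f x / c) \<le> 1" by (simp add: modular_def)
    then show ?thesis
      unfolding luxemburg_norm_def using c by (intro cInf_lower bdd_belowI[of _ 0]) auto
  qed
  have "sobolev_norm G \<Omega> (\<lambda>x. \<phi> x - \<phi> x) < \<epsilon>" if \<epsilon>: "0 < \<epsilon>" for \<epsilon>
    using lux[OF wg, of "\<epsilon> / 3"] lux[of "\<lambda>x. \<phi> x - \<phi> x" "\<epsilon> / 3"] \<epsilon> by (simp add: sobolev_norm_def)
  then show ?thesis using s \<phi> unfolding orlicz_sobolev_0_def by blast
qed

end

section \<open>The first eigenvalue\<close>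

text \<open>Countably many closed boxes cover \<Omega>, so \<open>w\<close> is not a.e. zero on one
  of them. The bump of that box is nonzero on it up to the null set of its faces.\<close>

lemma test_function_seeing_weight:
  fixes w :: "real ^ 'n \<Rightarrow> real"
  assumes \<Omega>: "open \<Omega>" and w: "\<not> (AE x in lebesgue_on \<Omega>. w x = 0)"
  obtains \<phi> where "\<phi> \<in> test_functions \<Omega>" "\<And>x. 0 \<le> \<phi> x" "\<And>x. \<phi> x \<le> 1"
    "\<not> (AE x in lebesgue_on \<Omega>. \<phi> x = 0 \<or> w x = 0)"
proof -
  have \<Omega>l: "\<Omega> \<in> sets lebesgue" using \<Omega> by auto
  obtain D where D: "countable D" "D \<subseteq> Pow \<Omega>" "\<And>X. X \<in> D \<Longrightarrow> \<exists>a b. X = cbox a b" "\<Union>D = \<Omega>"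
    by (rule open_countable_Union_open_cbox[OF \<Omega>]) blast
  have "\<exists>X\<in>D. \<not> (AE x in lebesgue_on \<Omega>. x \<in> X \<longrightarrow> w x = 0)"
  proof (rule ccontr)
    assume "\<not> ?thesis"
    then have "AE x in lebesgue_on \<Omega>. \<forall>X\<in>D. x \<in> X \<longrightarrow> w x = 0"
      unfolding AE_ball_countable[OF D(1)] by blast
    moreover have "AE x in lebesgue_on \<Omega>. x \<in> \<Omega>" by (rule AE_I2) simp
    ultimately have "AE x in lebesgue_on \<Omega>. w x = 0"
    proof eventually_elim
      case (elim x)
      then show ?case using D(4) by blast
    qed
    with w show False by simp
  qed
  then obtain X where X: "X \<in> D" "\<not> (AE x in lebesgue_on \<Omega>. x \<in> X \<longrightarrow> w x = 0)" by blast
  obtain a b where ab: "X = cbox a b" using D(3)[OF X(1)] by blast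
  have sub: "cbox a b \<subseteq> \<Omega>" using D(2) X(1) ab by blast
  show thesis
  proof (rule that[of "box_bump 1 a b"])
    show "box_bump 1 a b \<in> test_functions \<Omega>" by (rule box_bump_test_function[OF _ sub]) simp
    show "0 \<le> box_bump 1 a b x" "box_bump 1 a b x \<le> 1" for x
      by (simp_all add: box_bump_nonneg box_bump_le_1)
    show "\<not> (AE x in lebesgue_on \<Omega>. box_bump 1 a b x = 0 \<or> w x = 0)"
    proof
      assume "AE x in lebesgue_on \<Omega>. box_bump 1 a b x = 0 \<or> w x = 0"
      moreover have "AE x in lebesgue_on \<Omega>. x \<notin> cbox a b - box a b"
      proof -
        have "AE x in lebesgue. x \<notin> cbox a b - box a b"
          using negligible_frontier_interval[of a b] by (intro AE_not_in) (simp add: negligible_iff_null_sets)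
        then have "AE x in lebesgue. x \<in> \<Omega> \<longrightarrow> x \<notin> cbox a b - box a b" by (rule eventually_mono) blast
        then show ?thesis using \<Omega>l by (subst AE_restrict_space_iff) simp_all
      qed
      ultimately have "AE x in lebesgue_on \<Omega>. x \<in> X \<longrightarrow> w x = 0"
      proof eventually_elim
        case (elim x)
        then show ?case unfolding box_bump_eq_0_iff ab by blast
      qed
      with X(2) show False by simp
    qed
  qed
qed

text \<open>The energy of \<open>t * \<phi>\<close> depends continuously on \<open>t\<close> by
  dominated convergence, is 0 at \<open>t = 0\<close> and exceeds 1 or equals it for large
  \<open>t\<close>; the intermediate value theorem gives energy 1.\<close>

lemma admissible_nonempty:
  fixes w :: "real ^ 'n \<Rightarrow> real"
  assumes G: "young G g" and H: "young H h" and \<Omega>: "bounded \<Omega>" "open \<Omega>"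
    and wm: "w \<in> borel_measurable (lebesgue_on \<Omega>)" and w0: "AE x in lebesgue_on \<Omega>. 0 \<le> w x"
    and wB: "AE x in lebesgue_on \<Omega>. w x \<le> W" and w: "\<not> (AE x in lebesgue_on \<Omega>. w x = 0)"
  shows "admissible G H \<Omega> w 1 \<noteq> {}"
proof -
  interpret H: young H h by (rule H)
  obtain \<phi> where \<phi>: "\<phi> \<in> test_functions \<Omega>" "\<And>x. 0 \<le> \<phi> x" "\<And>x. \<phi> x \<le> 1"
    "\<not> (AE x in lebesgue_on \<Omega>. \<phi> x = 0 \<or> w x = 0)"
    by (rule test_function_seeing_weight[OF \<Omega>(2) w]) blast
  have fin: "finite_measure (lebesgue_on \<Omega>)"
    using \<Omega> by (intro finite_measure_lebesgue_on bounded_set_imp_lmeasurable) auto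
  note [measurable] = wm
  have [measurable]: "\<phi> \<in> borel_measurable (lebesgue_on \<Omega>)"
    using young.test_orlicz_space(3)[OF G \<Omega> \<phi>(1)] .
  define F where "F t x = w x * H \<bar>t * \<phi> x\<bar>" for t x
  have [measurable]: "F t \<in> borel_measurable (lebesgue_on \<Omega>)" for t unfolding F_def[abs_def] by measurable
  have bnd: "AE x in lebesgue_on \<Omega>. norm (F t x) \<le> W * H R" if t: "0 \<le> t" "t \<le> R" for t R
    using w0 wB
  proof eventually_elim
    case (elim x)
    have "t * \<phi> x \<le> R" using mult_mono[of t R "\<phi> x" 1] t \<phi>(2,3)[of x] by simp
    then have "H \<bar>t * \<phi> x\<bar> \<le> H R" using t \<phi>(2)[of x] by (intro H.mono_G) auto
    moreover have "0 \<le> H \<bar>t * \<phi> x\<bar>" by (rule H.G_nonneg) simp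
    ultimately show ?case using elim by (simp add: F_def abs_mult mult_mono)
  qed
  have int: "integrable (lebesgue_on \<Omega>) (F t)" if "0 \<le> t" for t
    by (rule finite_measure.integrable_const_bound[OF fin bnd[OF that order_refl]]) measurable
  have F0: "AE x in lebesgue_on \<Omega>. 0 \<le> F t x" for t
    using w0 by (rule eventually_mono) (simp add: F_def H.G_nonneg)
  define I where "I t = (LINT x|lebesgue_on \<Omega>. F t x)" for t
  have "I 1 \<noteq> 0"
  proof
    assume "I 1 = 0"
    then have "AE x in lebesgue_on \<Omega>. F 1 x = 0"
      using integral_nonneg_eq_0_iff_AE[OF int F0] by (simp add: I_def)
    then have "AE x in lebesgue_on \<Omega>. \<phi> x = 0 \<or> w x = 0"
    proof (rule eventually_mono)
      fix x assume "F 1 x = 0"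
      then show "\<phi> x = 0 \<or> w x = 0"
        using H.G_pos[of "\<bar>\<phi> x\<bar>"] by (cases "\<phi> x = 0") (auto simp: F_def)
    qed
    with \<phi>(4) show False by simp
  qed
  moreover have "0 \<le> I 1" unfolding I_def by (rule integral_nonneg_AE[OF F0])
  ultimately have I1: "0 < I 1" by simp
  \<comment> \<open>Convexity gives \<open>R * H s \<le> H (R * s)\<close> for
    \<open>R \<ge> 1\<close>, hence \<open>I R \<ge> R * I 1 \<ge> 1\<close>.\<close>
  define R where "R = max 1 (1 / I 1)"
  have R: "1 \<le> R" "1 \<le> R * I 1" using I1 by (auto simp: R_def max_def field_simps)
  have "R * I 1 \<le> I R"
  proof -
    have "R * I 1 = (LINT x|lebesgue_on \<Omega>. R * F 1 x)" by (simp add: I_def)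
    also have "\<dots> \<le> I R"
      unfolding I_def
    proof (rule integral_mono_AE)
      show "integrable (lebesgue_on \<Omega>) (\<lambda>x. R * F 1 x)" "integrable (lebesgue_on \<Omega>) (F R)"
        using int R(1) by simp_all
      show "AE x in lebesgue_on \<Omega>. R * F 1 x \<le> F R x"
        using w0
      proof (rule eventually_mono)
        fix x assume "0 \<le> w x"
        moreover have "R * H \<bar>\<phi> x\<bar> \<le> H \<bar>R * \<phi> x\<bar>"
          using H.scale_ge[OF R(1), of "\<bar>\<phi> x\<bar>"] R(1) by (simp add: abs_mult)
        ultimately have "w x * (R * H \<bar>\<phi> x\<bar>) \<le> w x * H \<bar>R * \<phi> x\<bar>" by (intro mult_left_mono)
        then show "R * F 1 x \<le> F R x" by (simp add: F_def mult_ac)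
      qed
    qed
    finally show ?thesis .
  qed
  then have IR: "1 \<le> I R" using R(2) by simp
  have cont: "continuous_on {0..R} I"
    unfolding continuous_on_sequentially
  proof (intro allI ballI impI, elim conjE)
    fix x a assume a: "a \<in> {0..R}" and x: "\<forall>n. x n \<in> {0..R}" and lim: "x \<longlonglongrightarrow> a"
    show "(I \<circ> x) \<longlonglongrightarrow> I a"
      unfolding I_def comp_def
    proof (rule integral_dominated_convergence)
      show "integrable (lebesgue_on \<Omega>) (\<lambda>x. W * H R)"
        using fin by (rule finite_measure.integrable_const)
      show "AE y in lebesgue_on \<Omega>. norm (F (x n) y) \<le> W * H R" for n
        using x by (intro bnd) auto
      show "AE y in lebesgue_on \<Omega>. (\<lambda>n. F (x n) y) \<longlonglongrightarrow> F a y"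
      proof (rule AE_I2)
        fix y
        have "isCont (\<lambda>s. H \<bar>s\<bar>) (a * \<phi> y)"
          using H.continuous_on_G_abs by (simp add: continuous_on_eq_continuous_at)
        moreover have "(\<lambda>n. x n * \<phi> y) \<longlonglongrightarrow> a * \<phi> y" by (intro tendsto_mult lim tendsto_const)
        ultimately have "(\<lambda>n. H \<bar>x n * \<phi> y\<bar>) \<longlonglongrightarrow> H \<bar>a * \<phi> y\<bar>" by (rule isCont_tendsto_compose)
        then show "(\<lambda>n. F (x n) y) \<longlonglongrightarrow> F a y" unfolding F_def by (intro tendsto_mult tendsto_const)
      qed
    qed measurable
  qed
  have "I 0 \<le> 1" by (simp add: I_def F_def)
  have "\<exists>t\<ge>0. t \<le> R \<and> I t = 1"
    by (rule IVT'[OF \<open>I 0 \<le> 1\<close> IR _ cont]) (use R(1) in simp)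
  then obtain t where t: "0 \<le> t" "I t = 1" by blast
  have "(\<lambda>x. t * \<phi> x) \<in> orlicz_sobolev_0 G \<Omega>"
    by (rule young.test_orlicz_sobolev_0[OF G \<Omega> test_functions_cmult[OF \<phi>(1)]])
  then have "(\<lambda>x. t * \<phi> x) \<in> admissible G H \<Omega> w 1"
    using t(2) by (simp add: admissible_def I_def F_def)
  then show ?thesis by blast
qed

section \<open>Calibration of the level and the two lower bounds\<close>

lemma regular_young_functionD: "regular_young_function G g \<Longrightarrow> young G g"
  by (simp add: regular_young_function_def young_def)

text \<open>Since 1/\<tau> \<le> e, the argument is at most b e / (2C). Convexity pulls out 1/(2C),
  and its C cancels the constant from splitting \<open>H (b * e)\<close>. In the application
  \<open>H b\<close> and \<open>H e\<close> are the reciprocals of the sup norm of the weight and of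
  the measure of \<Omega>.\<close>

lemma young_inv_mult_le:
  assumes H: "young H h" and C: "1 \<le> C" "\<And>a b. 0 \<le> a \<Longrightarrow> 0 \<le> b \<Longrightarrow> H (a * b) \<le> C * H a * H b"
    and b: "0 < b" and e: "0 < e" and \<tau>: "1 \<le> e * \<tau>" "0 < \<tau>"
  shows "H (b / (2 * C * \<tau>)) \<le> H b * H e / 2"
proof -
  interpret H: young H h by (rule H)
  have "b / (2 * C * \<tau>) \<le> 1 / (2 * C) * (b * e)"
  proof -
    have "1 / \<tau> \<le> e" using \<tau> by (simp add: pos_divide_le_eq)
    then have "b / (2 * C) * (1 / \<tau>) \<le> b / (2 * C) * e" using b C(1) by (intro mult_left_mono) auto
    then show ?thesis by simp
  qed
  then have "H (b / (2 * C * \<tau>)) \<le> H (1 / (2 * C) * (b * e))"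
    using b C(1) \<tau>(2) by (intro H.mono_G) auto
  also have "\<dots> \<le> 1 / (2 * C) * H (b * e)" using b e C(1) by (intro H.scale_le) auto
  also have "\<dots> \<le> 1 / (2 * C) * (C * H b * H e)" using b e C by (intro mult_left_mono) auto
  also have "\<dots> = H b * H e / 2" using C(1) by simp
  finally show ?thesis .
qed

text \<open>Splitting G at (1/\<delta>) times the gradient norm turns the hypothesis on the energy
  into modular at most 1 at level \<delta>, to which \<open>orlicz_sobolev_0_bound\<close>
  applies.\<close>

lemma eigenvalue_admissible_bound:
  fixes u w :: "real ^ 'n \<Rightarrow> real"
  assumes G: "young G g" and C: "1 \<le> C" "\<And>a b. 0 \<le> a \<Longrightarrow> 0 \<le> b \<Longrightarrow> G (a * b) \<le> C * G a * G b"
    and T: "T_int G CARD('n) < \<infinity>" and \<Omega>: "bounded \<Omega>" "open \<Omega>" "\<Omega> \<noteq> {}"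
    and u: "u \<in> orlicz_sobolev_0 G \<Omega>" and \<delta>: "0 < \<delta>"
    and L: "C * G (1 / \<delta>) * (LINT x|lebesgue_on \<Omega>. G (norm (weak_gradient \<Omega> u x))) \<le> 1"
  shows "AE x in lebesgue_on \<Omega>. \<bar>u x\<bar> \<le> 2 * \<delta> * morrey_sigma G CARD('n) (inner_radius \<Omega>)"
proof -
  interpret young G g by (rule G)
  define N where "N x = norm (weak_gradient \<Omega> u x)" for x
  have N0: "0 \<le> N x" for x by (simp add: N_def)
  have "N \<in> orlicz_space G \<Omega>"
    using u by (simp add: orlicz_sobolev_0_def orlicz_sobolev_def N_def[abs_def])
  then have [measurable]: "N \<in> borel_measurable (lebesgue_on \<Omega>)" and fin: "modular G \<Omega> N < \<infinity>"
    by (auto simp: orlicz_space_def)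
  have Gm [measurable]: "(\<lambda>x. G (N x)) \<in> borel_measurable (lebesgue_on \<Omega>)"
    using borel_measurable_G_norm[of N "lebesgue_on \<Omega>"] N0 by simp
  \<comment> \<open>Without integrability the Bochner integral in \<open>L\<close> would be 0 and
    carry no information; membership in the Sobolev space supplies it.\<close>
  have int: "integrable (lebesgue_on \<Omega>) (\<lambda>x. G (N x))"
    by (rule integrableI_nonneg[OF Gm]) (use fin N0 G_nonneg in \<open>auto simp: modular_def\<close>)
  define \<Lambda> where "\<Lambda> = (LINT x|lebesgue_on \<Omega>. G (N x))"
  have modN: "modular G \<Omega> N = ennreal \<Lambda>"
    using nn_integral_eq_integral[OF int] N0 G_nonneg by (simp add: modular_def \<Lambda>_def)
  define c where "c = C * G (1 / \<delta>)"
  have c: "0 \<le> c" using C(1) \<delta> G_nonneg[of "1 / \<delta>"] by (simp add: c_def)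
  have "modular G \<Omega> (\<lambda>x. N x / \<delta>) \<le> (\<integral>\<^sup>+x. ennreal c * ennreal (G \<bar>N x\<bar>) \<partial>lebesgue_on \<Omega>)"
    unfolding modular_def
  proof (rule nn_integral_mono)
    fix x
    have "G \<bar>N x / \<delta>\<bar> \<le> c * G \<bar>N x\<bar>"
      using C(2)[of "1 / \<delta>" "N x"] \<delta> N0[of x] by (simp add: c_def)
    then show "ennreal (G \<bar>N x / \<delta>\<bar>) \<le> ennreal c * ennreal (G \<bar>N x\<bar>)"
      using c G_nonneg[of "\<bar>N x\<bar>"] by (simp add: ennreal_mult[symmetric] ennreal_leI)
  qed
  also have "\<dots> = ennreal c * modular G \<Omega> N"
    unfolding modular_def by (rule nn_integral_cmult) measurable
  also have "\<dots> = ennreal (c * \<Lambda>)" unfolding modN using c by (simp add: ennreal_mult')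
  also have "\<dots> \<le> 1" using L by (simp add: c_def \<Lambda>_def N_def)
  finally have "modular G \<Omega> (\<lambda>x. norm (weak_gradient \<Omega> u x) / \<delta>) \<le> 1" by (simp add: N_def)
  then show ?thesis by (rule orlicz_sobolev_0_bound[OF T \<Omega> u \<delta>])
qed

theorem theorem4p4:
  fixes G g H h :: "real \<Rightarrow> real"
  assumes "regular_young_function G g" and "regular_young_function H h"
    and "Delta_prime G" and "Delta_prime H"
    and "T_int G CARD('n::finite) < \<infinity>"
  shows "\<exists>c\<^sub>3>0. \<exists>c\<^sub>3'>0. \<forall>(\<Omega> :: (real ^ 'n) set) (w :: real ^ 'n \<Rightarrow> real).
    bounded \<Omega> \<and> open \<Omega> \<and> lipschitz_boundary \<Omega> \<and>
    w \<in> Linf_space \<Omega> \<and> (AE x in lebesgue_on \<Omega>. 0 \<le> w x) \<and> \<not> (AE x in lebesgue_on \<Omega>. w x = 0)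
    \<longrightarrow>
    inverse (G (c\<^sub>3 * morrey_sigma G CARD('n) (inner_radius \<Omega>) / young_inv H (inverse (L1_norm \<Omega> w))))
      \<le> first_eigenvalue G H \<Omega> w 1 \<and>
    inverse (G (c\<^sub>3' * morrey_sigma G CARD('n) (inner_radius \<Omega>) * tau H \<Omega> / young_inv H (inverse (Linf_norm \<Omega> w))))
      \<le> first_eigenvalue G H \<Omega> w 1"
proof -
  have G: "young G g" and H: "young H h" using assms regular_young_functionD by auto
  interpret G: young G g by (rule G)
  interpret H: young H h by (rule H)
  obtain C where C: "1 \<le> C" "\<And>a b. 0 \<le> a \<Longrightarrow> 0 \<le> b \<Longrightarrow> G (a * b) \<le> C * G a * G b"
    using assms(3) unfolding Delta_prime_def by blast
  obtain E where E: "1 \<le> E" "\<And>a b. 0 \<le> a \<Longrightarrow> 0 \<le> b \<Longrightarrow> H (a * b) \<le> E * H a * H b"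
    using assms(4) unfolding Delta_prime_def by blast
  have main: "inverse (G (4 * C * morrey_sigma G CARD('n) (inner_radius \<Omega>) / young_inv H (inverse (L1_norm \<Omega> w))))
      \<le> first_eigenvalue G H \<Omega> w 1 \<and>
    inverse (G (4 * C * E * morrey_sigma G CARD('n) (inner_radius \<Omega>) * tau H \<Omega> / young_inv H (inverse (Linf_norm \<Omega> w))))
      \<le> first_eigenvalue G H \<Omega> w 1"
    if \<Omega>: "bounded \<Omega>" "open \<Omega>" and wL: "w \<in> Linf_space \<Omega>" and w0: "AE x in lebesgue_on \<Omega>. 0 \<le> w x"
      and wn: "\<not> (AE x in lebesgue_on \<Omega>. w x = 0)" for \<Omega> :: "(real ^ 'n) set" and w
  proof -
    have \<Omega>l: "\<Omega> \<in> sets lebesgue" and \<Omega>m: "\<Omega> \<in> lmeasurable"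
      using \<Omega> by (auto intro: bounded_set_imp_lmeasurable)
    have fin: "finite_measure (lebesgue_on \<Omega>)" by (rule finite_measure_lebesgue_on[OF \<Omega>m])
    have "\<Omega> \<noteq> {}"
    proof
      assume "\<Omega> = {}"
      then have "AE x in lebesgue_on \<Omega>. w x = 0" by (intro AE_I2) simp
      with wn show False by simp
    qed
    then obtain x0 where "x0 \<in> \<Omega>" by blast
    then obtain z where r: "0 < inner_radius \<Omega>" by (rule inner_radius_boundary_point[OF \<Omega>])
    define \<sigma> where "\<sigma> = morrey_sigma G CARD('n) (inner_radius \<Omega>)"
    have \<sigma>: "0 < \<sigma>" unfolding \<sigma>_def by (rule G.morrey_sigma_pos[OF assms(5) _ r]) simp
    have wm [measurable]: "w \<in> borel_measurable (lebesgue_on \<Omega>)" using wL by (simp add: Linf_space_def)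
    define W where "W = Linf_norm \<Omega> w"
    have WB: "AE x in lebesgue_on \<Omega>. \<bar>w x\<bar> \<le> W" and W: "0 < W"
    proof -
      let ?e = "esssup (lebesgue_on \<Omega>) (\<lambda>x. ereal \<bar>w x\<bar>)"
      have e: "AE x in lebesgue_on \<Omega>. ereal \<bar>w x\<bar> \<le> ?e" by (rule esssup_AE)
      have "?e < \<infinity>" using wL by (simp add: Linf_space_def)
      \<comment> \<open>\<open>real_of_ereal\<close> sends infinite values to 0, so both must be
        excluded. Minus infinity would force \<open>w\<close> to vanish almost everywhere.\<close>
      moreover have "?e \<noteq> -\<infinity>"
      proof
        assume "?e = -\<infinity>"
        from e have "AE x in lebesgue_on \<Omega>. w x = 0"
          by (rule eventually_mono) (simp add: \<open>?e = -\<infinity>\<close>)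
        with wn show False by simp
      qed
      ultimately have W_eq: "?e = ereal W" unfolding W_def Linf_norm_def by (cases ?e) auto
      show WB: "AE x in lebesgue_on \<Omega>. \<bar>w x\<bar> \<le> W" using e unfolding W_eq by simp
      show "0 < W"
      proof (rule ccontr)
        assume "\<not> 0 < W"
        then have "AE x in lebesgue_on \<Omega>. w x = 0" using WB by (auto elim!: eventually_mono)
        with wn show False by simp
      qed
    qed
    have w_int: "integrable (lebesgue_on \<Omega>) w"
      by (rule finite_measure.integrable_const_bound[OF fin _ wm, of W]) (use WB in simp)
    define m where "m = measure lebesgue \<Omega>"
    have m: "0 < m"
    proof (rule ccontr)
      assume "\<not> 0 < m"
      then have "m = 0" using measure_nonneg[of lebesgue \<Omega>] by (simp add: m_def)
      then have "\<Omega> \<in> null_sets lebesgue"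
        using \<Omega>m \<Omega>l by (simp add: null_sets_def m_def emeasure_eq_measure2)
      then have "AE x in lebesgue. x \<notin> \<Omega>" by (rule AE_not_in)
      then have "AE x in lebesgue. x \<in> \<Omega> \<longrightarrow> w x = 0" by (rule eventually_mono) blast
      then have "AE x in lebesgue_on \<Omega>. w x = 0" using \<Omega>l by (subst AE_restrict_space_iff) simp_all
      with wn show False by simp
    qed
    define l where "l = L1_norm \<Omega> w"
    have l: "0 < l"
    proof -
      have "l \<noteq> 0"
      proof
        assume "l = 0"
        then have "AE x in lebesgue_on \<Omega>. \<bar>w x\<bar> = 0"
          using integral_nonneg_eq_0_iff_AE[OF integrable_abs[OF w_int]] by (simp add: l_def L1_norm_def)
        with wn show False by simp
      qed
      moreover have "0 \<le> l" by (simp add: l_def L1_norm_def)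
      ultimately show ?thesis by simp
    qed
    \<comment> \<open>\<open>X\<close> stands for the value of G whose reciprocal is the claimed
      bound. A gradient energy below \<open>inverse X\<close> makes \<open>|u|\<close> at most
      \<open>2 * \<delta> * \<sigma>\<close>, too small for energy 1.\<close>
    have contra: False
      if u: "u \<in> admissible G H \<Omega> w 1" and \<delta>: "0 < \<delta>" and X: "C * G (1 / \<delta>) \<le> X" "0 < X"
        and less: "(LINT x|lebesgue_on \<Omega>. G (norm (weak_gradient \<Omega> u x))) < inverse X"
        and small: "H (2 * \<delta> * \<sigma>) * l < 1 \<or> H (2 * \<delta> * \<sigma>) * (W * m) < 1" for u \<delta> X
    proof -
      have uW: "u \<in> orlicz_sobolev_0 G \<Omega>" and u1: "(LINT x|lebesgue_on \<Omega>. w x * H \<bar>u x\<bar>) = 1"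
        using u by (auto simp: admissible_def)
      let ?\<Lambda> = "LINT x|lebesgue_on \<Omega>. G (norm (weak_gradient \<Omega> u x))"
      have "0 \<le> ?\<Lambda>" by (intro Bochner_Integration.integral_nonneg G.G_nonneg) simp
      then have "C * G (1 / \<delta>) * ?\<Lambda> \<le> X * ?\<Lambda>" using X(1) by (intro mult_right_mono)
      also have "\<dots> \<le> X * inverse X" using less X(2) by (intro mult_left_mono) auto
      finally have L: "C * G (1 / \<delta>) * ?\<Lambda> \<le> 1" using X(2) by simp
      have ub: "AE x in lebesgue_on \<Omega>. \<bar>u x\<bar> \<le> 2 * \<delta> * \<sigma>"
        unfolding \<sigma>_def
        by (rule eigenvalue_admissible_bound[OF G C assms(5) \<Omega> \<open>\<Omega> \<noteq> {}\<close> uW \<delta> L])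
      define M where "M = H (2 * \<delta> * \<sigma>)"
      have M: "0 \<le> M" using \<delta> \<sigma> by (simp add: M_def H.G_nonneg)
      \<comment> \<open>A non-integrable function would have Bochner integral 0, not 1.\<close>
      have i1: "integrable (lebesgue_on \<Omega>) (\<lambda>x. w x * H \<bar>u x\<bar>)"
        using u1 not_integrable_integral_eq by fastforce
      have "AE x in lebesgue_on \<Omega>. w x * H \<bar>u x\<bar> \<le> M * \<bar>w x\<bar>"
        using ub w0
      proof eventually_elim
        case (elim x)
        then have "H \<bar>u x\<bar> \<le> M" unfolding M_def by (intro H.mono_G) auto
        then show ?case using elim by (simp add: mult.commute[of "w x"] mult_right_mono)
      qed
      then have "1 \<le> (LINT x|lebesgue_on \<Omega>. M * \<bar>w x\<bar>)"
        unfolding u1[symmetric] using w_int by (intro integral_mono_AE i1) auto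
      then have "1 \<le> M * l" by (simp add: l_def L1_norm_def)
      \<comment> \<open>Reduces the sup-norm alternative in \<open>small\<close> to the same
        inequality for \<open>l\<close>.\<close>
      moreover have "l \<le> W * m"
      proof -
        have "l \<le> (LINT x|lebesgue_on \<Omega>. W)"
          unfolding l_def L1_norm_def using w_int WB
          by (intro integral_mono_AE finite_measure.integrable_const[OF fin]) auto
        also have "\<dots> = W * m" using \<Omega>l by (simp add: m_def measure_restrict_space mult.commute)
        finally show ?thesis .
      qed
      then have "M * l \<le> M * (W * m)" using M by (rule mult_left_mono)
      ultimately show False using small by (auto simp: M_def)
    qed
    have eig: "inverse X \<le> first_eigenvalue G H \<Omega> w 1"
      if \<delta>: "0 < \<delta>" and X: "C * G (1 / \<delta>) \<le> X" "0 < X"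
        and small: "H (2 * \<delta> * \<sigma>) * l < 1 \<or> H (2 * \<delta> * \<sigma>) * (W * m) < 1" for \<delta> X
      unfolding first_eigenvalue_def
    proof (rule cINF_greatest)
      have "AE x in lebesgue_on \<Omega>. w x \<le> W" using WB by (rule eventually_mono) simp
      then show "admissible G H \<Omega> w 1 \<noteq> {}"
        by (rule admissible_nonempty[OF G H \<Omega> wm w0 _ wn])
      fix u assume u: "u \<in> admissible G H \<Omega> w 1"
      then have "(LINT x|lebesgue_on \<Omega>. w x * H \<bar>u x\<bar>) = 1" by (simp add: admissible_def)
      then show "inverse X \<le> (LINT x|lebesgue_on \<Omega>. G (norm (weak_gradient \<Omega> u x))) /
          (LINT x|lebesgue_on \<Omega>. w x * H \<bar>u x\<bar>)"
        using contra[OF u \<delta> X _ small] by (simp add: not_less[symmetric]) blast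
    qed
    have scale: "C * G (1 / \<delta>) \<le> G (C * (1 / \<delta>))" if "0 < \<delta>" for \<delta>
      using G.scale_ge[OF C(1), of "1 / \<delta>"] that by simp
    show ?thesis
    proof
      define a where "a = young_inv H (inverse l)"
      have a: "0 < a" "H a = inverse l" using l by (auto simp: a_def H.young_inv_pos H.G_young_inv)
      \<comment> \<open>Then \<open>2 * \<delta> * \<sigma>\<close> is \<open>a / 2\<close>, where H
        is at most half of \<open>inverse l\<close>.\<close>
      define \<delta> where "\<delta> = a / (4 * \<sigma>)"
      have \<delta>: "0 < \<delta>" using a \<sigma> by (simp add: \<delta>_def)
      have "H (2 * \<delta> * \<sigma>) \<le> 1 / 2 * H a"
        using H.scale_le[of "1 / 2" a] a \<sigma> by (simp add: \<delta>_def)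
      then have "H (2 * \<delta> * \<sigma>) * l \<le> 1 / 2 * H a * l" using l by (intro mult_right_mono) auto
      also have "\<dots> < 1" using a l by simp
      finally have "inverse (G (C * (1 / \<delta>))) \<le> first_eigenvalue G H \<Omega> w 1"
        using \<delta> C(1) by (intro eig[OF \<delta> scale[OF \<delta>]] G.G_pos) auto
      moreover have "C * (1 / \<delta>) = 4 * C * \<sigma> / a" by (simp add: \<delta>_def)
      ultimately show "inverse (G (4 * C * morrey_sigma G CARD('n) (inner_radius \<Omega>) / young_inv H (inverse (L1_norm \<Omega> w))))
          \<le> first_eigenvalue G H \<Omega> w 1"
        by (simp only: \<sigma>_def a_def l_def)
    next
      define b where "b = young_inv H (inverse W)"
      have b: "0 < b" "H b = inverse W" using W by (auto simp: b_def H.young_inv_pos H.G_young_inv)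
      define e where "e = young_inv H (inverse m)"
      have e: "0 < e" "H e = inverse m" using m by (auto simp: e_def H.young_inv_pos H.G_young_inv)
      define \<tau> where "\<tau> = tau H \<Omega>"
      have \<tau>_eq: "\<tau> = m * young_inv (complementary H) (inverse m)" by (simp add: \<tau>_def tau_def m_def)
      have "inverse m \<le> e * young_inv (complementary H) (inverse m)"
        unfolding e_def using m by (intro H.le_young_inv_mult_complementary) simp
      then have "m * inverse m \<le> m * (e * young_inv (complementary H) (inverse m))"
        using m by (intro mult_left_mono) auto
      then have \<tau>: "1 \<le> e * \<tau>" using m by (simp add: \<tau>_eq mult_ac)
      then have \<tau>0: "0 < \<tau>" using e(1) by (metis less_le_trans zero_less_mult_pos zero_less_one)
      \<comment> \<open>Chosen so that \<open>2 * \<delta> * \<sigma>\<close> is the argument in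
        \<open>young_inv_mult_le\<close>, whose bound is half the reciprocal of
        \<open>W * m\<close>.\<close>
      define \<delta> where "\<delta> = b / (4 * E * \<sigma> * \<tau>)"
      have \<delta>: "0 < \<delta>" using b \<sigma> E(1) \<tau>0 by (simp add: \<delta>_def)
      have "2 * \<delta> * \<sigma> = b / (2 * E * \<tau>)" using \<sigma> by (simp add: \<delta>_def)
      then have "H (2 * \<delta> * \<sigma>) \<le> H b * H e / 2"
        using young_inv_mult_le[OF H E b(1) e(1) \<tau> \<tau>0] by simp
      then have "H (2 * \<delta> * \<sigma>) * (W * m) \<le> H b * H e / 2 * (W * m)" using W m by (intro mult_right_mono) auto
      also have "\<dots> < 1" using b(2) e(2) W m by (simp add: field_simps)
      finally have "inverse (G (C * (1 / \<delta>))) \<le> first_eigenvalue G H \<Omega> w 1"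
        using \<delta> C(1) by (intro eig[OF \<delta> scale[OF \<delta>]] G.G_pos) auto
      moreover have "C * (1 / \<delta>) = 4 * C * E * \<sigma> * \<tau> / b" by (simp add: \<delta>_def)
      ultimately show "inverse (G (4 * C * E * morrey_sigma G CARD('n) (inner_radius \<Omega>) * tau H \<Omega> / young_inv H (inverse (Linf_norm \<Omega> w))))
          \<le> first_eigenvalue G H \<Omega> w 1"
        by (simp only: \<sigma>_def b_def W_def \<tau>_def)
    qed
  qed
  have pos: "0 < 4 * C" "0 < 4 * C * E" using C(1) E(1) by auto
  show ?thesis
    by (rule exI[of _ "4 * C"], rule conjI[OF pos(1)], rule exI[of _ "4 * C * E"], rule conjI[OF pos(2)],
      intro allI impI, elim conjE, rule main)
qed

end
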